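(* Let $(\Omega_1,\mathcal A_1)$, $(\Omega_2,\mathcal A_2)$ be measurable spaces, $\mathcal P\subset\mathcal M_1(\Omega_1,\mathcal A_1)$ and $\mathcal Q\subset\mathcal M_1(\Omega_2,\mathcal A_2)$ nonempty families of probability measures, and $\mathcal P\otimes\mathcal Q=\{P\otimes Q:P\in\mathcal P,Q\in\mathcal Q\}$. Let $k:\mathcal P\otimes\mathcal Q\to\mathbb R$ be differentiable at $P_0\otimes Q_0\in\mathcal P\otimes\mathcal Q$, let $\dot k\in L_2(P_0\otimes Q_0)$ be a gradient of $k$ at $P_0\otimes Q_0$ and let $\widetilde k\in L_2^{(0)}(P_0\otimes Q_0)$ be the canonical gradient of $k$ at $P_0\otimes Q_0$. Then: 1. The functionals $k_1:\mathcal P\to\mathbb R$, $P\mapsto k(P\otimes Q_0)$, and $k_2:\mathcal Q\to\mathbb R$, $Q\mapsto k(P_0\otimes Q)$, are differentiable at $P_0$ and at $Q_0$, respectively. 2. The map $\dot k_1:\omega_1\mapsto\int\dot k(\omega_1,\omega_2)\,dQ_0(\omega_2)$ is a gradient of $k_1$ at $P_0$, and the map $\dot k_2:\omega_2\mapsto\int\dot k(\omega_1,\omega_2)\,dP_0(\omega_1)$ is a gradient of $k_2$ at $Q_0$. 3. The map $\widetilde k_1:\omega_1\mapsto\int\widetilde k(\omega_1,\omega_2)\,dQ_0(\omega_2)$ is the canonical gradient of $k_1$ at $P_0$, and the map $\widetilde k_2:\omega_2\mapsto\int\widetilde k(\omega_1,\omega_2)\,dP_0(\omega_1)$ is the canonical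 gradient of $k_2$ at $Q_0$. Moreover $\widetilde k=\widetilde k_1\circ\pi_1+\widetilde k_2\circ\pi_2$.
   Context: $\mathcal M_1(\Omega,\mathcal A)$ is the set of probability measures on $(\Omega,\mathcal A)$. For $P,Q\in\mathcal M_1(\Omega,\mathcal A)$, $\frac{dP}{dQ}$ denotes the density quotient: a measurable $L:\Omega\to[0,\infty]$ with $P(A)=\int_A L\,dQ+P(A\cap\{L=\infty\})$ for all $A\in\mathcal A$ and $Q(L<\infty)=1$. For a nonempty family $\mathcal R\subset\mathcal M_1(\Omega,\mathcal A)$, a map $(-\varepsilon,\varepsilon)\to\mathcal R$, $t\mapsto R_t$ ($\varepsilon>0$) is an $L_2(R_0)$-differentiable curve in $\mathcal R$ with tangent $g\in L_2(R_0)$ if, as $t\to0$, $\bigl\|2\bigl((dR_t/dR_0)^{1/2}-1\bigr)-tg\bigr\|_{L_2(R_0)}=o(|t|)$ and $R_t(\{dR_t/dR_0=\infty\})=o(t^2)$. Tangents lie in $L_2^{(0)}(R)=\{h\in L_2(R):\int h\,dR=0\}$, $R=R_0$. The tangent cone $K(R,\mathcal R)$ is the set of tangents of all $L_2(R_0)$-differentiable curves in $\mathcal R$ with $R_0=R$; the tangent space $T(R,\mathcal R)$ is the $L_2(R)$-closure of the linear span of $K(R,\mathcal R)$. A functional $k:\mathcal R\to\mathbb R$ is differentiable at $R\in\mathcal R$ with gradient $\dot k\in L_2^{(0)}(R)$ if for every $L_2(R_0)$-differentiable curve $t\mapsto R_t$ in $\mathcal R$ with tangent $g$ and $R_0=R$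 one has $\lim_{t\downarrow0}\frac1t(k(R_t)-k(R_0))=\int\dot k g\,dR_0$. The canonical gradient is the unique gradient lying in $T(R,\mathcal R)$ (equivalently, the gradient of minimal $L_2(R)$-norm). $\pi_1,\pi_2$ are the coordinate projections of $\Omega_1\times\Omega_2$. *)

theory Defs
  imports "HOL-Probability.Probability" "HOL-Library.Landau_Symbols"
begin

definition is_density_quotient :: "'a measure \<Rightarrow> 'a measure \<Rightarrow> ('a \<Rightarrow> ennreal) \<Rightarrow> bool" where
  "is_density_quotient P Q L \<longleftrightarrow>
     L \<in> borel_measurable Q \<and>
     (\<forall>A\<in>sets Q. emeasure P A =
        (\<integral>\<^sup>+x\<in>A. L x \<partial>Q) + emeasure P (A \<inter> {x \<in> space Q. L x = \<infinity>})) \<and>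
     emeasure Q {x \<in> space Q. L x < \<infinity>} = 1"

text \<open>Elements of the \<open>L\<^sub>2\<close> spaces are functions, not equivalence classes; equality in
  \<open>L\<^sub>2(R)\<close> is equality \<open>R\<close>-almost everywhere.\<close>

definition L2 :: "'a measure \<Rightarrow> ('a \<Rightarrow> real) set" where
  "L2 R = {g \<in> borel_measurable R. integrable R (\<lambda>x. (g x)\<^sup>2)}"

definition L2_zero :: "'a measure \<Rightarrow> ('a \<Rightarrow> real) set" where
  "L2_zero R = {h \<in> L2 R. (\<integral>x. h x \<partial>R) = 0}"

definition L2_norm :: "'a measure \<Rightarrow> ('a \<Rightarrow> real) \<Rightarrow> real" where
  "L2_norm R g = sqrt (\<integral>x. (g x)\<^sup>2 \<partial>R)"

text \<open>Density quotients are unique up to sets that are null for both measures, so the condition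
  does not depend on the versions \<open>L t\<close>.
  The function inside the norm is always in \<open>L\<^sub>2(R\<^sub>0)\<close>, since the integral of
  \<open>L t\<close> is at most 1 and \<open>L t\<close> is finite \<open>R\<^sub>0\<close>-almost everywhere.
  The values \<open>R t\<close> outside of \<open>(-\<epsilon>,\<epsilon>)\<close> are irrelevant.\<close>

definition L2_differentiable_curve ::
  "'a measure set \<Rightarrow> (real \<Rightarrow> 'a measure) \<Rightarrow> ('a \<Rightarrow> real) \<Rightarrow> bool" where
  "L2_differentiable_curve \<R> R g \<longleftrightarrow>
     g \<in> L2 (R 0) \<and>
     (\<exists>\<epsilon>>0. \<exists>L.
        (\<forall>t\<in>{-\<epsilon><..<\<epsilon>}. R t \<in> \<R> \<and> is_density_quotient (R t) (R 0) (L t)) \<and>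
        (\<lambda>t. L2_norm (R 0) (\<lambda>x. 2 * (sqrt (enn2real (L t x)) - 1) - t * g x))
           \<in> o[at 0](\<lambda>t. \<bar>t\<bar>) \<and>
        (\<lambda>t. measure (R t) {x \<in> space (R 0). L t x = \<infinity>}) \<in> o[at 0](\<lambda>t. t\<^sup>2))"

definition tangent_cone :: "'a measure \<Rightarrow> 'a measure set \<Rightarrow> ('a \<Rightarrow> real) set" where
  "tangent_cone R0 \<R> = {g. \<exists>R. L2_differentiable_curve \<R> R g \<and> R 0 = R0}"

definition linear_span :: "('a \<Rightarrow> real) set \<Rightarrow> ('a \<Rightarrow> real) set" where
  "linear_span K = {\<lambda>x. \<Sum>f\<in>F. c f * f x | F c. finite F \<and> F \<subseteq> K}"

definition L2_closure :: "'a measure \<Rightarrow> ('a \<Rightarrow> real) set \<Rightarrow> ('a \<Rightarrow> real) set" where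
  "L2_closure R S = {h \<in> L2 R. \<forall>e>0. \<exists>g\<in>S. L2_norm R (\<lambda>x. h x - g x) < e}"

definition tangent_space :: "'a measure \<Rightarrow> 'a measure set \<Rightarrow> ('a \<Rightarrow> real) set" where
  "tangent_space R \<R> = L2_closure R (linear_span (tangent_cone R \<R>))"

definition is_gradient ::
  "'a measure set \<Rightarrow> ('a measure \<Rightarrow> real) \<Rightarrow> 'a measure \<Rightarrow> ('a \<Rightarrow> real) \<Rightarrow> bool" where
  "is_gradient \<R> k R0 kd \<longleftrightarrow>
     R0 \<in> \<R> \<and> kd \<in> L2_zero R0 \<and>
     (\<forall>R g. L2_differentiable_curve \<R> R g \<and> R 0 = R0 \<longrightarrow>
        ((\<lambda>t. (k (R t) - k (R 0)) / t) \<longlongrightarrow> (\<integral>x. kd x * g x \<partial>R0)) (at_right 0))"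

definition functional_differentiable ::
  "'a measure set \<Rightarrow> ('a measure \<Rightarrow> real) \<Rightarrow> 'a measure \<Rightarrow> bool" where
  "functional_differentiable \<R> k R0 \<longleftrightarrow> (\<exists>kd. is_gradient \<R> k R0 kd)"

definition is_canonical_gradient ::
  "'a measure set \<Rightarrow> ('a measure \<Rightarrow> real) \<Rightarrow> 'a measure \<Rightarrow> ('a \<Rightarrow> real) \<Rightarrow> bool" where
  "is_canonical_gradient \<R> k R0 kt \<longleftrightarrow>
     is_gradient \<R> k R0 kt \<and> kt \<in> tangent_space R0 \<R> \<and>
     (\<forall>h. is_gradient \<R> k R0 h \<and> h \<in> tangent_space R0 \<R> \<longrightarrow> (AE x in R0. h x = kt x))"

definition product_family :: "'a measure set \<Rightarrow> 'b measure set \<Rightarrow> ('a \<times> 'b) measure set" where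
  "product_family \<P> \<Q> = {P \<Otimes>\<^sub>M Q | P Q. P \<in> \<P> \<and> Q \<in> \<Q>}"

end

theory Submission
  imports Defs
begin

text \<open>The curve \<open>t \<mapsto> P\<^sub>t \<otimes> Q\<^sub>0\<close> has tangent \<open>g \<circ> \<pi>\<^sub>1\<close> if \<open>P\<^sub>t\<close> has tangent \<open>g\<close>, and the adjoint of
  \<open>g \<mapsto> g \<circ> \<pi>\<^sub>1\<close> in \<open>L\<^sub>2\<close> integrates over the second coordinate; so it maps gradients of \<open>k\<close> to
  gradients of \<open>k\<^sub>1\<close>. Conversely, if \<open>P\<^sub>t \<otimes> Q\<^sub>t\<close> has tangent \<open>g\<close>, then \<open>P\<^sub>t\<close> and \<open>Q\<^sub>t\<close> have the
  coordinate integrals \<open>g\<^sub>1\<close> and \<open>g\<^sub>2\<close> of \<open>g\<close> as tangents, and \<open>g = g\<^sub>1 \<circ> \<pi>\<^sub>1 + g\<^sub>2 \<circ> \<pi>\<^sub>2\<close>. Both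
  statements pass from the tangent cone to the closure of its span because the coordinate
  integrals are linear contractions, and a gradient in the tangent space is canonical.\<close>

section \<open>Square-integrable functions\<close>

text \<open>A curve need not be dominated by its starting measure, and its tangent is only asked to
  be square integrable. So the value \<infinity> of a quotient has to be carried through products
  and marginals, and the mean of a tangent has to be shown to vanish. In the converse only a
  quotient of the product measures is given. Quotients of the factors come from the Lebesgue
  decomposition, and almost everywhere uniqueness identifies the given root with
  \<open>f * h\<close>, where \<open>f\<close> and \<open>h\<close> are the roots of the factors.
  Integrating \<open>f * h\<close> over the second coordinate yields a multiple \<open>a * f\<close>
  instead of \<open>f\<close>; this is the obstacle, and it is harmless only because
  \<open>1 - a\<close> turns out to be of smaller order than \<open>t\<close>. The splitting of the
  tangent comes from \<open>2 * (f * h - 1) = 2 * (f - 1) + 2 * (h - 1) + 2 * (f - 1) * (h -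
  1)\<close>: on a product measure the norm of the last term is a product of two norms, each at most
  linear in \<open>t\<close>, so it has order \<open>t\<^sup>2\<close>.\<close>

lemma L2_measurable: "f \<in> L2 M \<Longrightarrow> f \<in> borel_measurable M"
  by (simp add: L2_def)

lemma L2_integrable_square: "f \<in> L2 M \<Longrightarrow> integrable M (\<lambda>x. (f x)\<^sup>2)"
  by (simp add: L2_def)

lemma L2_zero_imp_L2: "f \<in> L2_zero M \<Longrightarrow> f \<in> L2 M"
  by (simp add: L2_zero_def)

lemma L2_mult_integrable:
  assumes "f \<in> L2 M" "g \<in> L2 M"
  shows "integrable M (\<lambda>x. f x * g x)"
proof (rule Bochner_Integration.integrable_bound)
  show "integrable M (\<lambda>x. (f x)\<^sup>2 + (g x)\<^sup>2)"
    using assms by (simp add: L2_def)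
  show "(\<lambda>x. f x * g x) \<in> borel_measurable M"
    by (intro borel_measurable_times L2_measurable assms)
  have "\<bar>a * b\<bar> \<le> a\<^sup>2 + b\<^sup>2" for a b :: real
    using sum_squares_bound[of "\<bar>a\<bar>" "\<bar>b\<bar>"] mult_nonneg_nonneg[of "\<bar>a\<bar>" "\<bar>b\<bar>"]
    unfolding abs_mult power2_abs by linarith
  then show "AE x in M. norm (f x * g x) \<le> norm ((f x)\<^sup>2 + (g x)\<^sup>2)"
    by simp
qed

lemma L2_add:
  assumes "f \<in> L2 M" "g \<in> L2 M"
  shows "(\<lambda>x. f x + g x) \<in> L2 M"
  using assms L2_mult_integrable[OF assms] unfolding L2_def by (auto simp: power2_sum mult.assoc)

lemma L2_cmult: "f \<in> L2 M \<Longrightarrow> (\<lambda>x. c * f x) \<in> L2 M"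
  unfolding L2_def mem_Collect_eq power_mult_distrib
  by (intro conjI integrable_mult_right borel_measurable_times borel_measurable_const) blast+

lemma L2_diff:
  assumes "f \<in> L2 M" "g \<in> L2 M"
  shows "(\<lambda>x. f x - g x) \<in> L2 M"
  using L2_add[OF assms(1) L2_cmult[OF assms(2), of "-1"]] by simp

lemma L2_null: "(\<lambda>x. 0) \<in> L2 M"
  by (simp add: L2_def)

lemma L2_sum: "(\<And>i. i \<in> I \<Longrightarrow> f i \<in> L2 M) \<Longrightarrow> (\<lambda>x. \<Sum>i\<in>I. f i x) \<in> L2 M"
  by (induction I rule: infinite_finite_induct) (auto intro: L2_add L2_null)

lemma (in prob_space) L2_const: "(\<lambda>x. c) \<in> L2 M"
  by (simp add: L2_def)

lemma (in prob_space) L2_integrable: "f \<in> L2 M \<Longrightarrow> integrable M f"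
  by (rule square_integrable_imp_integrable[OF L2_measurable L2_integrable_square])

lemma L2_norm_nonneg: "0 \<le> L2_norm M f"
  by (simp add: L2_norm_def)

lemma L2_norm_square: "(L2_norm M f)\<^sup>2 = (\<integral>x. (f x)\<^sup>2 \<partial>M)"
  by (simp add: L2_norm_def)

lemma L2_norm_cong_AE:
  assumes "AE x in M. f x = g x" "f \<in> borel_measurable M" "g \<in> borel_measurable M"
  shows "L2_norm M f = L2_norm M g"
  unfolding L2_norm_def using assms by (intro arg_cong[where f = sqrt] integral_cong_AE) auto

lemma L2_norm_cmult: "L2_norm M (\<lambda>x. c * f x) = \<bar>c\<bar> * L2_norm M f"
  by (simp add: L2_norm_def power_mult_distrib real_sqrt_mult)

lemma L2_norm_eq_0_iff: "f \<in> L2 M \<Longrightarrow> L2_norm M f = 0 \<longleftrightarrow> (AE x in M. f x = 0)"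
  unfolding L2_norm_def by (subst real_sqrt_eq_0_iff, subst integral_nonneg_eq_0_iff_AE) (auto simp: L2_def)

lemma L2_Cauchy_Schwarz:
  assumes f: "f \<in> L2 M" and g: "g \<in> L2 M"
  shows "\<bar>\<integral>x. f x * g x \<partial>M\<bar> \<le> L2_norm M f * L2_norm M g"
proof -
  note [measurable] = L2_measurable[OF f] L2_measurable[OF g]
  let ?I = "\<integral>x. \<bar>f x\<bar> * \<bar>g x\<bar> \<partial>M"
  have int: "integrable M (\<lambda>x. \<bar>f x\<bar> * \<bar>g x\<bar>)"
    using L2_mult_integrable[OF f g] by (simp flip: abs_mult)
  have "(\<integral>\<^sup>+x. ennreal \<bar>f x\<bar> * ennreal \<bar>g x\<bar> \<partial>M)\<^sup>2
      \<le> (\<integral>\<^sup>+x. (ennreal \<bar>f x\<bar>)\<^sup>2 \<partial>M) * (\<integral>\<^sup>+x. (ennreal \<bar>g x\<bar>)\<^sup>2 \<partial>M)"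
    by (rule Cauchy_Schwarz_nn_integral) auto
  also have "(\<integral>\<^sup>+x. ennreal \<bar>f x\<bar> * ennreal \<bar>g x\<bar> \<partial>M) = ennreal ?I"
    using int by (simp flip: ennreal_mult add: nn_integral_eq_integral)
  also have "(\<integral>\<^sup>+x. (ennreal \<bar>f x\<bar>)\<^sup>2 \<partial>M) = ennreal ((L2_norm M f)\<^sup>2)"
    using f by (simp add: ennreal_power nn_integral_eq_integral L2_def L2_norm_square)
  also have "(\<integral>\<^sup>+x. (ennreal \<bar>g x\<bar>)\<^sup>2 \<partial>M) = ennreal ((L2_norm M g)\<^sup>2)"
    using g by (simp add: ennreal_power nn_integral_eq_integral L2_def L2_norm_square)
  finally have "?I\<^sup>2 \<le> (L2_norm M f * L2_norm M g)\<^sup>2"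
    by (simp add: ennreal_power power_mult_distrib flip: ennreal_mult)
  then have "?I \<le> L2_norm M f * L2_norm M g"
    by (rule power2_le_imp_le) (simp add: L2_norm_nonneg)
  moreover have "\<bar>\<integral>x. f x * g x \<partial>M\<bar> \<le> ?I"
    using integral_abs_bound[of M "\<lambda>x. f x * g x"] by (simp add: abs_mult)
  ultimately show ?thesis by linarith
qed

lemma (in prob_space) L2_norm_const: "L2_norm M (\<lambda>x. c) = \<bar>c\<bar>"
  by (simp add: L2_norm_def prob_space)

lemma (in prob_space) abs_integral_le_L2_norm:
  "f \<in> L2 M \<Longrightarrow> \<bar>\<integral>x. f x \<partial>M\<bar> \<le> L2_norm M f"
  using L2_Cauchy_Schwarz[OF _ L2_const[of 1], of f] by (simp add: L2_norm_const)

lemma L2_norm_triangle: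
  assumes f: "f \<in> L2 M" and g: "g \<in> L2 M"
  shows "L2_norm M (\<lambda>x. f x + g x) \<le> L2_norm M f + L2_norm M g"
proof (rule power2_le_imp_le)
  have "(L2_norm M (\<lambda>x. f x + g x))\<^sup>2 = (L2_norm M f)\<^sup>2 + (L2_norm M g)\<^sup>2 + 2 * (\<integral>x. f x * g x \<partial>M)"
    using f g L2_mult_integrable[OF f g]
    by (simp add: L2_norm_square power2_sum mult.assoc L2_def)
  also have "\<dots> \<le> (L2_norm M f + L2_norm M g)\<^sup>2"
    using L2_Cauchy_Schwarz[OF f g] by (simp add: power2_sum)
  finally show "(L2_norm M (\<lambda>x. f x + g x))\<^sup>2 \<le> (L2_norm M f + L2_norm M g)\<^sup>2" .
qed (simp add: L2_norm_nonneg)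

lemma L2_norm_triangle_diff:
  assumes f: "f \<in> L2 M" and g: "g \<in> L2 M"
  shows "L2_norm M (\<lambda>x. f x - g x) \<le> L2_norm M f + L2_norm M g"
  using L2_norm_triangle[OF f L2_cmult[OF g, of "-1"]] L2_norm_cmult[of M "-1" g] by simp

section \<open>Density quotients\<close>

text \<open>Among the \<open>Q\<close>-null sets, \<open>N\<close> is one of maximal
  \<open>P\<close>-mass: the union of a maximizing sequence. Maximality makes the restriction of
  \<open>P\<close> to the complement absolutely continuous, so that Radon-Nikodym applies.\<close>

lemma Lebesgue_decomposition:
  assumes "finite_measure P" "sigma_finite_measure Q" and sets: "sets P = sets Q"
  obtains N f where "N \<in> null_sets Q" "f \<in> borel_measurable Q"
    "density P (indicator (space Q - N)) = density Q f"
proof -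
  interpret P: finite_measure P by fact
  interpret Q: sigma_finite_measure Q by fact
  note [measurable_cong] = sets
  have sp: "space P = space Q" using sets by (rule sets_eq_imp_space_eq)
  define S where "S = (SUP A\<in>null_sets Q. measure P A)"
  have bdd: "bdd_above (measure P ` null_sets Q)"
    by (rule bdd_aboveI2[where M = "measure P (space P)"]) (rule P.bounded_measure)
  have null_sets_nonempty: "null_sets Q \<noteq> {}" by auto
  have le_S: "measure P A \<le> S" if "A \<in> null_sets Q" for A
    unfolding S_def using that bdd by (rule cSUP_upper)
  have "\<exists>A\<in>null_sets Q. S - 1 / Suc n < measure P A" for n
  proof -
    have "S - 1 / Suc n < S" by simp
    then show ?thesis
      unfolding S_def using less_cSUP_iff[OF null_sets_nonempty bdd] by blast
  qed
  then obtain A where A: "\<And>n. A n \<in> null_sets Q" "\<And>n. S - 1 / Suc n < measure P (A n)"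
    by metis
  define N where "N = (\<Union>n. A n)"
  have N: "N \<in> null_sets Q" unfolding N_def using A(1) by auto
  then have [measurable]: "N \<in> sets Q" by auto
  have "S - 1 / Suc n \<le> measure P N" for n
  proof -
    have "measure P (A n) \<le> measure P N"
    proof (rule P.finite_measure_mono)
      show "A n \<subseteq> N" unfolding N_def by (rule UN_upper) simp
      show "N \<in> sets P" unfolding sets by measurable
    qed
    with A(2)[of n] show ?thesis by linarith
  qed
  then have "S \<le> measure P N + 1 / Suc n" for n
    by (metis add.commute diff_le_eq)
  moreover have "(\<lambda>n. measure P N + 1 / real (Suc n)) \<longlonglongrightarrow> measure P N + 0"
    by (intro tendsto_intros LIMSEQ_Suc[OF lim_1_over_n])
  ultimately have S_le: "S \<le> measure P N"
    by (intro LIMSEQ_le_const) auto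
  have "absolutely_continuous Q (density P (indicator (space Q - N)))"
    unfolding absolutely_continuous_def
  proof
    fix C assume C: "C \<in> null_sets Q"
    then have [measurable]: "C \<in> sets Q" by auto
    \<comment> \<open>\<open>C \<union> N\<close> is \<open>Q\<close>-null as well, and
      \<open>N\<close> already attains the supremum \<open>S\<close>; nothing is left for
      \<open>C - N\<close>.\<close>
    have "measure P (C - N) + measure P N = measure P (C \<union> N)"
      by (subst P.finite_measure_Union[symmetric]) (auto simp: sets intro!: arg_cong[where f = "measure P"])
    also have "\<dots> \<le> S" using C N by (intro le_S) auto
    finally have 0: "measure P (C - N) = 0"
      using S_le measure_nonneg[of P "C - N"] by linarith
    have "emeasure (density P (indicator (space Q - N))) C
        = (\<integral>\<^sup>+x. indicator (space Q - N) x * indicator C x \<partial>P)"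
      by (rule emeasure_density) (simp_all only: sets, measurable)
    also have "\<dots> = (\<integral>\<^sup>+x. indicator (C - N) x \<partial>P)"
      by (rule nn_integral_cong) (auto simp: sp indicator_def)
    also have "\<dots> = 0"
      using 0 by (simp add: sets P.emeasure_eq_measure)
    finally show "C \<in> null_sets (density P (indicator (space Q - N)))"
      by (auto simp: null_sets_def sets)
  qed
  from Q.Radon_Nikodym[OF this] obtain f where
    "f \<in> borel_measurable Q" "density Q f = density P (indicator (space Q - N))"
    using sets by auto
  with N that show thesis by metis
qed

text \<open>This form replaces a family of set identities by one equality of measures, which can be
  restricted by further densities and multiplied with another such equality. Existence, uniqueness
  and products of quotients all go through it.\<close>

lemma density_quotient_iff:
  assumes "prob_space Q" and sets: "sets P = sets Q"
  shows "is_density_quotient P Q L \<longleftrightarrow>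
    L \<in> borel_measurable Q \<and> (AE x in Q. L x < \<infinity>) \<and>
    density P (indicator {x. L x < \<infinity>}) = density Q (\<lambda>x. L x * indicator {x. L x < \<infinity>} x)"
    (is "_ \<longleftrightarrow> ?R")
proof -
  interpret Q: prob_space Q by fact
  note [measurable_cong] = sets
  have sp: "space P = space Q" using sets by (rule sets_eq_imp_space_eq)
  have AE_iff: "emeasure Q {x \<in> space Q. L x < \<infinity>} = 1 \<longleftrightarrow> (AE x in Q. L x < \<infinity>)"
    if [measurable]: "L \<in> borel_measurable Q"
    by (rule Q.AE_iff_emeasure_eq_1[symmetric]) measurable
  have ind: "indicator {x \<in> space Q. L x < \<infinity>} x = indicator {x. L x < \<infinity>} x" if "x \<in> space Q" for x
    using that by (simp add: indicator_def)
  have dP: "emeasure (density P (indicator {x. L x < \<infinity>})) A = emeasure P (A \<inter> {x \<in> space Q. L x < \<infinity>})"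
    if [measurable]: "L \<in> borel_measurable Q" "A \<in> sets Q" for A
  proof -
    have [measurable]: "indicator {x. L x < \<infinity>} \<in> borel_measurable P" by measurable
    have B: "A \<inter> {x \<in> space Q. L x < \<infinity>} \<in> sets P" unfolding sets by measurable
    have "emeasure (density P (indicator {x. L x < \<infinity>})) A
        = (\<integral>\<^sup>+x. indicator {x. L x < \<infinity>} x * indicator A x \<partial>P)"
      by (rule emeasure_density) (simp_all only: sets that, measurable)
    also have "\<dots> = (\<integral>\<^sup>+x. indicator (A \<inter> {x \<in> space Q. L x < \<infinity>}) x \<partial>P)"
      by (rule nn_integral_cong) (auto simp: sp indicator_def)
    finally show ?thesis using B by simp
  qed
  have dQ: "emeasure (density Q (\<lambda>x. L x * indicator {x. L x < \<infinity>} x)) A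
    = (\<integral>\<^sup>+x\<in>A \<inter> {x \<in> space Q. L x < \<infinity>}. L x \<partial>Q)"
    if [measurable]: "L \<in> borel_measurable Q" "A \<in> sets Q" for A
    by (subst emeasure_density) (auto intro!: nn_integral_cong split: split_indicator)
  show ?thesis
  proof
    assume L: "is_density_quotient P Q L"
    then have [measurable]: "L \<in> borel_measurable Q"
      and eq: "\<And>A. A \<in> sets Q \<Longrightarrow> emeasure P A =
        (\<integral>\<^sup>+x\<in>A. L x \<partial>Q) + emeasure P (A \<inter> {x \<in> space Q. L x = \<infinity>})"
      and AE: "AE x in Q. L x < \<infinity>"
      using AE_iff by (auto simp: is_density_quotient_def)
    have "density P (indicator {x. L x < \<infinity>}) = density Q (\<lambda>x. L x * indicator {x. L x < \<infinity>} x)"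
    proof (rule measure_eqI)
      fix A assume "A \<in> sets (density P (indicator {x. L x < \<infinity>}))"
      then have A[measurable]: "A \<in> sets Q" by (simp add: sets)
      \<comment> \<open>The defining identity is applied to the part of \<open>A\<close> where
        \<open>L\<close> is finite, where the singular term is the measure of the empty set.\<close>
      have "A \<inter> {x \<in> space Q. L x < \<infinity>} \<inter> {x \<in> space Q. L x = \<infinity>} = {}" by auto
      then have "emeasure P (A \<inter> {x \<in> space Q. L x < \<infinity>}) = (\<integral>\<^sup>+x\<in>A \<inter> {x \<in> space Q. L x < \<infinity>}. L x \<partial>Q)"
        by (subst eq) (auto simp del: top.not_eq_extremum infinity_ennreal_def)
      then show "emeasure (density P (indicator {x. L x < \<infinity>})) A
          = emeasure (density Q (\<lambda>x. L x * indicator {x. L x < \<infinity>} x)) A"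
        by (subst dP, simp, simp) (subst dQ, simp_all)
    qed (simp add: sets)
    with AE show ?R by simp
  next
    assume R: ?R
    then have [measurable]: "L \<in> borel_measurable Q" by simp
    have "emeasure P A = (\<integral>\<^sup>+x\<in>A. L x \<partial>Q) + emeasure P (A \<inter> {x \<in> space Q. L x = \<infinity>})"
      if A[measurable]: "A \<in> sets Q" for A
    proof -
      have "A = (A \<inter> {x \<in> space Q. L x < \<infinity>}) \<union> (A \<inter> {x \<in> space Q. L x = \<infinity>})"
        using sets.sets_into_space[OF A] by (auto simp: less_top)
      then have "emeasure P A
          = emeasure P (A \<inter> {x \<in> space Q. L x < \<infinity>}) + emeasure P (A \<inter> {x \<in> space Q. L x = \<infinity>})"
        by (subst plus_emeasure) (auto simp: sets)
      also have "emeasure P (A \<inter> {x \<in> space Q. L x < \<infinity>}) = (\<integral>\<^sup>+x\<in>A \<inter> {x \<in> space Q. L x < \<infinity>}. L x \<partial>Q)"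
        using R dP[of A] dQ[of A] by simp
      also have "\<dots> = (\<integral>\<^sup>+x\<in>A. L x \<partial>Q)"
        using R by (intro nn_integral_cong_AE) (auto elim!: eventually_mono split: split_indicator)
      finally show ?thesis .
    qed
    then show "is_density_quotient P Q L"
      unfolding is_density_quotient_def using R AE_iff by blast
  qed
qed

text \<open>The quotient is the Radon-Nikodym density off the singular set \<open>N\<close> and
  \<infinity> on \<open>N\<close>; since \<open>N\<close> is \<open>Q\<close>-null, the value
  \<infinity> only marks where the singular part of \<open>P\<close> sits.\<close>

lemma density_quotient_exists:
  assumes "prob_space P" "prob_space Q" and sets: "sets P = sets Q"
  obtains L where "is_density_quotient P Q L"
proof -
  interpret P: prob_space P by fact
  interpret Q: prob_space Q by fact
  obtain N f where N: "N \<in> null_sets Q" and f[measurable]: "f \<in> borel_measurable Q"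
    and eq: "density P (indicator (space Q - N)) = density Q f"
    using Lebesgue_decomposition[OF P.finite_measure_axioms Q.sigma_finite_measure_axioms sets] .
  note [measurable_cong] = sets
  have sp: "space P = space Q" using sets by (rule sets_eq_imp_space_eq)
  have [measurable]: "N \<in> sets Q" using N by auto
  define L where "L x = (if x \<in> N then \<infinity> else f x)" for x
  have L[measurable]: "L \<in> borel_measurable Q" unfolding L_def by measurable
  have "(\<integral>\<^sup>+x. f x \<partial>Q) = emeasure (density P (indicator (space Q - N))) (space Q)"
    unfolding eq by (subst emeasure_density) (auto intro!: nn_integral_cong)
  also have "\<dots> = emeasure P (space Q - N)"
    apply (subst emeasure_density)
      apply measurable
    apply (subst nn_integral_indicator[symmetric])
     apply (simp add: sets)
    apply (rule nn_integral_cong)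
    apply (auto simp: sp indicator_def)
    done
  finally have fin: "(\<integral>\<^sup>+x. f x \<partial>Q) \<noteq> \<infinity>" by simp
  have "AE x in Q. f x \<noteq> \<infinity>"
    by (rule nn_integral_PInf_AE) (use fin in auto)
  moreover have "AE x in Q. x \<notin> N" using N by (rule AE_not_in)
  ultimately have AE: "AE x in Q. L x < \<infinity>"
    by eventually_elim (simp add: L_def less_top)
  let ?F = "indicator {x. L x < \<infinity>} :: _ \<Rightarrow> ennreal"
  \<comment> \<open>A point with finite \<open>L\<close> lies outside \<open>N\<close>, so
    restricting to the complement of \<open>N\<close> first changes nothing.\<close>
  have "density P ?F = density (density P (indicator (space Q - N))) ?F"
    apply (subst density_density_eq)
      apply (simp add: sets)
     apply measurable
    apply (rule density_cong)
      apply measurable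
    apply (rule AE_I2)
    using sp by (auto simp: L_def split: split_indicator)
  also have "\<dots> = density Q (\<lambda>x. f x * ?F x)"
    unfolding eq by (subst density_density_eq) measurable
  also have "\<dots> = density Q (\<lambda>x. L x * ?F x)"
    by (rule density_cong) (auto simp: L_def split: split_indicator)
  finally have "is_density_quotient P Q L"
    unfolding density_quotient_iff[OF assms(2,3)] using AE L by blast
  then show thesis by (rule that)
qed

lemma density_quotient_self:
  assumes "prob_space Q"
  shows "is_density_quotient Q Q (\<lambda>_. 1)"
  using prob_space.emeasure_space_1[OF assms] by (simp add: is_density_quotient_def)

lemma density_quotient_nn_integral_le:
  assumes "is_density_quotient P Q L"
  shows "(\<integral>\<^sup>+x. L x \<partial>Q) \<le> emeasure P (space Q)"
proof -
  have "emeasure P (space Q)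
      = (\<integral>\<^sup>+x\<in>space Q. L x \<partial>Q) + emeasure P (space Q \<inter> {x \<in> space Q. L x = \<infinity>})"
    using assms sets.top[of Q] unfolding is_density_quotient_def by blast
  also have "(\<integral>\<^sup>+x\<in>space Q. L x \<partial>Q) = (\<integral>\<^sup>+x. L x \<partial>Q)"
    by (rule nn_integral_cong) simp
  finally show ?thesis by simp
qed

text \<open>Restricting \<open>P\<close> to the set where both quotients are finite can be done in
  either order. This gives one measure with two \<open>Q\<close>-densities, and both cut-offs are 1
  almost everywhere for \<open>Q\<close>.\<close>

lemma density_quotient_unique:
  assumes "prob_space P" "prob_space Q" and sets: "sets P = sets Q"
    and L: "is_density_quotient P Q L" and L': "is_density_quotient P Q L'"
  shows "AE x in Q. L x = L' x"
proof -
  interpret P: prob_space P by fact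
  interpret Q: prob_space Q by fact
  note [measurable_cong] = sets
  let ?I = "indicator {x. L x < \<infinity>} :: _ \<Rightarrow> ennreal" and ?I' = "indicator {x. L' x < \<infinity>} :: _ \<Rightarrow> ennreal"
  have [measurable]: "L \<in> borel_measurable Q" "L' \<in> borel_measurable Q"
    and fin: "AE x in Q. L x < \<infinity>" "AE x in Q. L' x < \<infinity>"
    and eq: "density P ?I = density Q (\<lambda>x. L x * ?I x)" "density P ?I' = density Q (\<lambda>x. L' x * ?I' x)"
    using L L' unfolding density_quotient_iff[OF assms(2,3)] by blast+
  have [measurable]: "?I \<in> borel_measurable Q" "?I' \<in> borel_measurable Q"
    by measurable
  have [measurable]: "?I \<in> borel_measurable P" "?I' \<in> borel_measurable P"
    by measurable
  have dd: "density (density P ?I) ?I' = density P (\<lambda>x. ?I x * ?I' x)"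
    "density (density P ?I') ?I = density P (\<lambda>x. ?I' x * ?I x)"
    by (rule density_density_eq; measurable)+
  have "density Q (\<lambda>x. L x * ?I x * ?I' x) = density (density P ?I) ?I'"
    unfolding eq by (rule density_density_eq[symmetric]; measurable)
  also have "\<dots> = density (density P ?I') ?I"
    unfolding dd by (simp only: mult.commute)
  also have "\<dots> = density Q (\<lambda>x. L' x * ?I' x * ?I x)"
    unfolding eq by (rule density_density_eq; measurable)
  finally have densities: "density Q (\<lambda>x. L x * ?I x * ?I' x) = density Q (\<lambda>x. L' x * ?I' x * ?I x)" .
  \<comment> \<open>Uniqueness of densities is used in its version for a finite integral; the mass
    of \<open>P\<close> is the bound.\<close>
  have "(\<integral>\<^sup>+x. L x * ?I x * ?I' x \<partial>Q) \<le> (\<integral>\<^sup>+x. L x \<partial>Q)"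
    by (intro nn_integral_mono) (auto simp: indicator_def)
  also have "\<dots> \<le> emeasure P (space Q)"
    using L by (rule density_quotient_nn_integral_le)
  finally have "(\<integral>\<^sup>+x. L x * ?I x * ?I' x \<partial>Q) \<noteq> \<infinity>"
    by (auto simp: top_unique)
  then have "AE x in Q. L x * ?I x * ?I' x = L' x * ?I' x * ?I x"
    by (subst finite_density_unique[symmetric]) (use densities in auto)
  with fin show ?thesis
    by eventually_elim simp
qed

text \<open>The integral of \<open>L\<close> is the mass of the absolutely continuous part, hence at
  most 1, and \<open>enn2real\<close> can only lower it by sending \<infinity> to 0.\<close>

lemma density_quotient_sqrt:
  assumes "prob_space P" and sets: "sets P = sets Q" and L: "is_density_quotient P Q L"
  shows "(\<lambda>x. sqrt (enn2real (L x))) \<in> L2 Q" "L2_norm Q (\<lambda>x. sqrt (enn2real (L x))) \<le> 1"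
proof -
  interpret P: prob_space P by fact
  have sp: "space P = space Q" using sets by (rule sets_eq_imp_space_eq)
  have [measurable]: "L \<in> borel_measurable Q" using L by (simp add: is_density_quotient_def)
  have "(\<integral>\<^sup>+x. ennreal (enn2real (L x)) \<partial>Q) \<le> (\<integral>\<^sup>+x. L x \<partial>Q)"
    by (intro nn_integral_mono) (simp add: ennreal_enn2real_if)
  also have "\<dots> \<le> emeasure P (space Q)"
    using L by (rule density_quotient_nn_integral_le)
  finally have le: "(\<integral>\<^sup>+x. ennreal (enn2real (L x)) \<partial>Q) \<le> 1"
    by (simp add: P.emeasure_space_1 flip: sp)
  have int: "integrable Q (\<lambda>x. enn2real (L x))"
    by (rule integrableI_nonneg) (use le in \<open>auto intro: le_less_trans\<close>)
  then show "(\<lambda>x. sqrt (enn2real (L x))) \<in> L2 Q"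
    by (simp add: L2_def)
  have "ennreal (\<integral>x. enn2real (L x) \<partial>Q) \<le> 1"
    using le int by (subst nn_integral_eq_integral[symmetric]) auto
  then show "L2_norm Q (\<lambda>x. sqrt (enn2real (L x))) \<le> 1"
    by (simp add: L2_norm_def)
qed

text \<open>The value \<infinity> is prescribed by cases because \<open>\<infinity> * 0 = 0\<close>
  in \<open>ennreal\<close>: the plain product would be 0 where one quotient is infinite and the
  other vanishes, and would lose singular mass there. With the cases, the finiteness set is a
  rectangle and the two measure equalities multiply.\<close>

lemma density_quotient_pair:
  assumes "prob_space P" "prob_space P0" "prob_space Q" "prob_space Q0"
    and sets: "sets P = sets P0" "sets Q = sets Q0"
    and K: "is_density_quotient P P0 K" and L: "is_density_quotient Q Q0 L"
  shows "is_density_quotient (P \<Otimes>\<^sub>M Q) (P0 \<Otimes>\<^sub>M Q0)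
    (\<lambda>z. if K (fst z) = \<infinity> \<or> L (snd z) = \<infinity> then \<infinity> else K (fst z) * L (snd z))"
    (is "is_density_quotient _ _ ?KL")
proof -
  interpret P: prob_space P by fact
  interpret P0: prob_space P0 by fact
  interpret Q: prob_space Q by fact
  interpret Q0: prob_space Q0 by fact
  interpret PQ: pair_prob_space P Q ..
  interpret R0: pair_prob_space P0 Q0 ..
  have sets_pair: "sets (P \<Otimes>\<^sub>M Q) = sets (P0 \<Otimes>\<^sub>M Q0)"
    using sets by (rule sets_pair_measure_cong)
  note [measurable_cong] = sets
  let ?I1 = "indicator {x. K x < \<infinity>} :: _ \<Rightarrow> ennreal" and ?I2 = "indicator {x. L x < \<infinity>} :: _ \<Rightarrow> ennreal"
  have Km[measurable]: "K \<in> borel_measurable P0" and fin1: "AE x in P0. K x < \<infinity>"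
    and eq1: "density P ?I1 = density P0 (\<lambda>x. K x * ?I1 x)"
    using K unfolding density_quotient_iff[OF assms(2) sets(1)] by blast+
  have Lm[measurable]: "L \<in> borel_measurable Q0" and fin2: "AE x in Q0. L x < \<infinity>"
    and eq2: "density Q ?I2 = density Q0 (\<lambda>x. L x * ?I2 x)"
    using L unfolding density_quotient_iff[OF assms(4) sets(2)] by blast+
  have I_measurable: "?I1 \<in> borel_measurable P" "?I2 \<in> borel_measurable Q"
    "(\<lambda>x. K x * ?I1 x) \<in> borel_measurable P0" "(\<lambda>x. L x * ?I2 x) \<in> borel_measurable Q0"
    by measurable
  have KL_measurable[measurable]: "?KL \<in> borel_measurable (P0 \<Otimes>\<^sub>M Q0)"
    by measurable
  have "AE z in P0 \<Otimes>\<^sub>M Q0. K (fst z) < \<infinity> \<and> L (snd z) < \<infinity>"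
    by (rule R0.AE_pair_measure) (measurable, use fin1 fin2 in \<open>auto elim!: eventually_mono\<close>)
  then have fin: "AE z in P0 \<Otimes>\<^sub>M Q0. ?KL z < \<infinity>"
    by eventually_elim (auto simp: ennreal_mult_less_top)
  have fin_iff: "?KL z < \<infinity> \<longleftrightarrow> K (fst z) < \<infinity> \<and> L (snd z) < \<infinity>" for z
    by (auto simp: ennreal_mult_less_top less_top)
  \<comment> \<open>\<open>pair_measure_density\<close> asks for sigma-finiteness of the second
    factor, here a measure of mass at most 1.\<close>
  have "(\<integral>\<^sup>+x. ?I2 x * indicator (space Q) x \<partial>Q) \<le> (\<integral>\<^sup>+x. 1 \<partial>Q)"
    by (intro nn_integral_mono) (simp add: indicator_def)
  also have "\<dots> = 1"
    by (simp add: Q.emeasure_space_1)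
  finally have "emeasure (density Q ?I2) (space (density Q ?I2)) \<le> 1"
    unfolding space_density emeasure_density[OF I_measurable(2) sets.top] .
  then have "emeasure (density Q ?I2) (space (density Q ?I2)) \<noteq> \<infinity>"
    by (metis ennreal_one_neq_top infinity_ennreal_def neq_top_trans)
  then have sf: "sigma_finite_measure (density Q ?I2)"
    by (rule finite_measure.axioms(1)[OF finite_measureI])
  have "density (P \<Otimes>\<^sub>M Q) (indicator {z. ?KL z < \<infinity>})
      = density (P \<Otimes>\<^sub>M Q) (\<lambda>(x, y). ?I1 x * ?I2 y)"
    unfolding fin_iff by (intro arg_cong[where f = "density _"]) (auto simp: fun_eq_iff indicator_def)
  also have "\<dots> = density P ?I1 \<Otimes>\<^sub>M density Q ?I2"
    by (rule pair_measure_density[symmetric]) (intro I_measurable sf Q.sigma_finite_measure_axioms)+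
  also have "\<dots> = density P0 (\<lambda>x. K x * ?I1 x) \<Otimes>\<^sub>M density Q0 (\<lambda>x. L x * ?I2 x)"
    by (simp only: eq1 eq2)
  also have "\<dots> = density (P0 \<Otimes>\<^sub>M Q0) (\<lambda>(x, y). (K x * ?I1 x) * (L y * ?I2 y))"
    by (rule pair_measure_density) (intro I_measurable sf[unfolded eq2] Q0.sigma_finite_measure_axioms)+
  also have "\<dots> = density (P0 \<Otimes>\<^sub>M Q0) (\<lambda>z. ?KL z * indicator {z. ?KL z < \<infinity>} z)"
    unfolding fin_iff by (intro arg_cong[where f = "density _"]) (auto simp: fun_eq_iff indicator_def)
  finally show ?thesis
    unfolding density_quotient_iff[OF R0.prob_space_axioms sets_pair]
    using fin KL_measurable by blast
qed

section \<open>Measure-preserving projections\<close>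

text \<open>For a product, \<open>\<phi>\<close> is a coordinate projection and \<open>E\<close> integrates over the other coordinate.
  The adjunction determines \<open>E\<close> up to null sets, and makes it linear and contractive.\<close>

locale L2_projection =
  fixes R :: "'c measure" and P :: "'d measure"
    and \<phi> :: "'c \<Rightarrow> 'd" and E :: "('c \<Rightarrow> real) \<Rightarrow> 'd \<Rightarrow> real"
  assumes prob_R: "prob_space R"
    and proj_measurable [measurable]: "\<phi> \<in> measurable R P"
    and distr_proj: "distr R P \<phi> = P"
    and proj_L2: "h \<in> L2 R \<Longrightarrow> E h \<in> L2 P"
    and proj_adjoint: "h \<in> L2 R \<Longrightarrow> g \<in> L2 P \<Longrightarrow> (\<integral>z. h z * g (\<phi> z) \<partial>R) = (\<integral>x. E h x * g x \<partial>P)"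
begin

lemma prob_P: "prob_space P"
  using prob_space.prob_space_distr[OF prob_R proj_measurable] by (simp add: distr_proj)

lemma integral_pullback: "g \<in> borel_measurable P \<Longrightarrow> (\<integral>z. g (\<phi> z) \<partial>R) = (\<integral>x. (g x :: real) \<partial>P)"
  using integral_distr[OF proj_measurable, of g, unfolded distr_proj] by simp

lemma pullback_L2: "g \<in> L2 P \<Longrightarrow> (\<lambda>z. g (\<phi> z)) \<in> L2 R"
  using integrable_distr_eq[OF proj_measurable, of "\<lambda>x. (g x)\<^sup>2", unfolded distr_proj]
    measurable_compose[OF proj_measurable, of g borel] by (auto simp: L2_def)

lemma L2_norm_pullback: "g \<in> borel_measurable P \<Longrightarrow> L2_norm R (\<lambda>z. g (\<phi> z)) = L2_norm P g"
  unfolding L2_norm_def by (subst integral_pullback) simp_all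

lemma AE_pullback: "(AE x in P. Q x) \<Longrightarrow> AE z in R. Q (\<phi> z)"
  by (rule AE_distrD[OF proj_measurable, unfolded distr_proj])

text \<open>The adjunction tested with \<open>g = E h\<close> writes the squared norm of
  \<open>E h\<close> as an inner product of \<open>h\<close> with the pullback of
  \<open>E h\<close>. Cauchy-Schwarz applies, and the pullback is isometric.\<close>

lemma L2_norm_proj_le:
  assumes h: "h \<in> L2 R"
  shows "L2_norm P (E h) \<le> L2_norm R h"
proof -
  note Eh = proj_L2[OF h]
  have "(L2_norm P (E h))\<^sup>2 = (\<integral>x. E h x * E h x \<partial>P)"
    unfolding L2_norm_square by (simp only: power2_eq_square)
  also have "\<dots> = (\<integral>z. h z * E h (\<phi> z) \<partial>R)"
    by (rule proj_adjoint[OF h Eh, symmetric])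
  also have "\<dots> \<le> L2_norm R h * L2_norm R (\<lambda>z. E h (\<phi> z))"
    using L2_Cauchy_Schwarz[OF h pullback_L2[OF Eh]] by linarith
  also have "\<dots> = L2_norm R h * L2_norm P (E h)"
    by (simp only: L2_norm_pullback[OF L2_measurable[OF Eh]])
  finally have "L2_norm P (E h) * L2_norm P (E h) \<le> L2_norm R h * L2_norm P (E h)"
    by (simp only: power2_eq_square)
  then show ?thesis
    using L2_norm_nonneg[of P "E h"] L2_norm_nonneg[of R h]
    by (cases "L2_norm P (E h) = 0") (simp_all add: mult_le_cancel_right)
qed

text \<open>Testing with the difference \<open>E h - f\<close> itself shows that its norm is 0. The
  rules for \<open>E\<close> below are instances: it suffices to verify the adjunction for the
  claimed value.\<close>

lemma proj_unique:
  assumes h: "h \<in> L2 R" and f: "f \<in> L2 P"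
    and eq: "\<And>g. g \<in> L2 P \<Longrightarrow> (\<integral>z. h z * g (\<phi> z) \<partial>R) = (\<integral>x. f x * g x \<partial>P)"
  shows "AE x in P. E h x = f x"
proof -
  let ?d = "\<lambda>x. E h x - f x"
  have d: "?d \<in> L2 P" using L2_diff[OF proj_L2[OF h] f] .
  have "(L2_norm P ?d)\<^sup>2 = (\<integral>x. E h x * ?d x - f x * ?d x \<partial>P)"
    unfolding L2_norm_square by (simp only: power2_eq_square left_diff_distrib)
  also have "\<dots> = (\<integral>x. E h x * ?d x \<partial>P) - (\<integral>x. f x * ?d x \<partial>P)"
    by (intro Bochner_Integration.integral_diff L2_mult_integrable d f proj_L2 h)
  also have "\<dots> = 0"
    using eq[OF d] proj_adjoint[OF h d] by simp
  finally have "AE x in P. ?d x = 0"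
    using L2_norm_eq_0_iff[OF d] by simp
  then show ?thesis by eventually_elim simp
qed

lemma proj_pullback: "f \<in> L2 P \<Longrightarrow> AE x in P. E (\<lambda>z. f (\<phi> z)) x = f x"
  by (rule proj_unique)
     (auto intro!: pullback_L2 integral_pullback[where g = "\<lambda>x. f x * g x" for g] borel_measurable_times
       dest: L2_measurable)

text \<open>Linearity can only hold almost everywhere: for a coordinate integral there may be a null
  set of fibres on which some \<open>h i\<close> is not integrable and its integral is 0 by
  convention.\<close>

lemma proj_sum:
  assumes h: "\<And>i. i \<in> I \<Longrightarrow> h i \<in> L2 R"
  shows "AE x in P. E (\<lambda>z. \<Sum>i\<in>I. c i * h i z) x = (\<Sum>i\<in>I. c i * E (h i) x)"
proof (rule proj_unique)
  fix g assume g: "g \<in> L2 P"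
  have "(\<integral>z. (\<Sum>i\<in>I. c i * h i z) * g (\<phi> z) \<partial>R) = (\<integral>z. (\<Sum>i\<in>I. c i * (h i z * g (\<phi> z))) \<partial>R)"
    by (simp only: sum_distrib_right mult.assoc)
  also have "\<dots> = (\<Sum>i\<in>I. c i * (\<integral>z. h i z * g (\<phi> z) \<partial>R))"
    by (subst Bochner_Integration.integral_sum)
       (auto intro!: integrable_mult_right L2_mult_integrable h pullback_L2 g)
  also have "\<dots> = (\<Sum>i\<in>I. c i * (\<integral>x. E (h i) x * g x \<partial>P))"
    by (intro sum.cong refl) (simp only: proj_adjoint h g)
  also have "\<dots> = (\<integral>x. (\<Sum>i\<in>I. c i * (E (h i) x * g x)) \<partial>P)"
    by (subst Bochner_Integration.integral_sum)
       (auto intro!: integrable_mult_right L2_mult_integrable h proj_L2 g)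
  also have "\<dots> = (\<integral>x. (\<Sum>i\<in>I. c i * E (h i) x) * g x \<partial>P)"
    by (simp only: sum_distrib_right mult.assoc)
  finally show "(\<integral>z. (\<Sum>i\<in>I. c i * h i z) * g (\<phi> z) \<partial>R) = (\<integral>x. (\<Sum>i\<in>I. c i * E (h i) x) * g x \<partial>P)" .
qed (intro L2_sum L2_cmult proj_L2 h; assumption)+

lemma proj_diff:
  assumes h: "h \<in> L2 R" and h': "h' \<in> L2 R"
  shows "AE x in P. E (\<lambda>z. h z - h' z) x = E h x - E h' x"
  using proj_sum[of UNIV "\<lambda>b. if b then h else h'" "\<lambda>b. if b then 1 else -1"] h h'
  by (simp add: UNIV_bool)

lemma integral_proj:
  assumes h: "h \<in> L2 R"
  shows "(\<integral>x. E h x \<partial>P) = (\<integral>z. h z \<partial>R)"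
  using proj_adjoint[OF h prob_space.L2_const[OF prob_P, of 1]] by simp

text \<open>\<open>\<Phi>\<close> lifts a measure of the factor to the product. Along a lifted curve
  the difference quotients of \<open>k\<close> are those of \<open>k \<circ> \<Phi>\<close>, and the
  adjunction moves the limit to \<open>P\<close>.\<close>

lemma is_gradient_proj:
  assumes grad: "is_gradient \<R> k R kd" and P: "P \<in> \<P>" and lift: "\<Phi> P = R"
    and curve: "\<And>S g. L2_differentiable_curve \<P> S g \<Longrightarrow> S 0 = P \<Longrightarrow>
      L2_differentiable_curve \<R> (\<lambda>t. \<Phi> (S t)) (\<lambda>z. g (\<phi> z))"
  shows "is_gradient \<P> (\<lambda>p. k (\<Phi> p)) P (E kd)"
  unfolding is_gradient_def
proof (intro conjI allI impI)
  have kd: "kd \<in> L2_zero R" using grad by (simp add: is_gradient_def)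
  then show "E kd \<in> L2_zero P"
    by (simp add: L2_zero_def proj_L2 integral_proj)
  fix S g assume Sg: "L2_differentiable_curve \<P> S g \<and> S 0 = P"
  then have "g \<in> L2 P" by (auto simp: L2_differentiable_curve_def)
  then have "(\<integral>z. kd z * g (\<phi> z) \<partial>R) = (\<integral>x. E kd x * g x \<partial>P)"
    by (rule proj_adjoint[OF L2_zero_imp_L2[OF kd]])
  moreover have "((\<lambda>t. (k (\<Phi> (S t)) - k (\<Phi> (S 0))) / t) \<longlongrightarrow> (\<integral>z. kd z * g (\<phi> z) \<partial>R)) (at_right 0)"
    using grad curve[of S g] Sg lift unfolding is_gradient_def by blast
  ultimately show "((\<lambda>t. (k (\<Phi> (S t)) - k (\<Phi> (S 0))) / t) \<longlongrightarrow> (\<integral>x. E kd x * g x \<partial>P)) (at_right 0)"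
    by simp
qed (rule P)

lemma proj_linear_span:
  assumes K: "\<And>g. g \<in> K \<Longrightarrow> g \<in> L2 R \<and> E g \<in> K'" and s: "s \<in> linear_span K"
  obtains s' where "s' \<in> linear_span K'" "s' \<in> L2 P" "AE x in P. E s x = s' x"
proof -
  obtain F c where F: "finite F" "F \<subseteq> K" and s_eq: "s = (\<lambda>x. \<Sum>f\<in>F. c f * f x)"
    using s by (auto simp: linear_span_def)
  let ?s' = "\<lambda>x. \<Sum>f\<in>F. c f * E f x"
  \<comment> \<open>The span is defined by sums over sets of functions, and \<open>E\<close> may
    identify members of \<open>F\<close>; the coefficients of functions with the same image are
    added up.\<close>
  have "?s' x = (\<Sum>g\<in>E ` F. (\<Sum>f | f \<in> F \<and> E f = g. c f) * g x)" for x
  proof -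
    have "?s' x = (\<Sum>g\<in>E ` F. \<Sum>f | f \<in> F \<and> E f = g. c f * E f x)"
      by (rule sum.image_gen[OF F(1)])
    also have "\<dots> = (\<Sum>g\<in>E ` F. (\<Sum>f | f \<in> F \<and> E f = g. c f) * g x)"
      unfolding sum_distrib_right by (intro sum.cong refl) auto
    finally show ?thesis .
  qed
  then have "?s' = (\<lambda>x. \<Sum>g\<in>E ` F. (\<Sum>f | f \<in> F \<and> E f = g. c f) * g x)"
    by blast
  moreover have "finite (E ` F)" "E ` F \<subseteq> K'"
    using F K by auto
  ultimately have span: "?s' \<in> linear_span K'"
    unfolding linear_span_def mem_Collect_eq
    by (intro exI[of _ "E ` F"] exI[of _ "\<lambda>g. \<Sum>f | f \<in> F \<and> E f = g. c f"] conjI)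
  have L2: "?s' \<in> L2 P"
    using F K by (intro L2_sum L2_cmult proj_L2) auto
  have "AE x in P. E s x = ?s' x"
    unfolding s_eq using F K by (intro proj_sum) auto
  with span L2 show thesis by (rule that)
qed

lemma proj_tangent_space:
  assumes cone: "\<And>g. g \<in> tangent_cone R \<R> \<Longrightarrow> E g \<in> tangent_cone P \<P>"
    and h: "h \<in> tangent_space R \<R>"
  shows "E h \<in> tangent_space P \<P>"
proof -
  have hL: "h \<in> L2 R" and approx: "\<And>e. e > 0 \<Longrightarrow> \<exists>s\<in>linear_span (tangent_cone R \<R>). L2_norm R (\<lambda>z. h z - s z) < e"
    using h by (auto simp: tangent_space_def L2_closure_def)
  have cone': "g \<in> L2 R \<and> E g \<in> tangent_cone P \<P>" if "g \<in> tangent_cone R \<R>" for g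
    using that cone[OF that] by (auto simp: tangent_cone_def L2_differentiable_curve_def)
  show ?thesis
    unfolding tangent_space_def L2_closure_def
  proof (intro CollectI conjI allI impI proj_L2 hL)
    fix e :: real assume "e > 0"
    then obtain s where s: "s \<in> linear_span (tangent_cone R \<R>)" and e: "L2_norm R (\<lambda>z. h z - s z) < e"
      using approx by blast
    have sL: "s \<in> L2 R"
      using s cone' by (force simp: linear_span_def intro!: L2_sum L2_cmult)
    obtain s' where s': "s' \<in> linear_span (tangent_cone P \<P>)" "s' \<in> L2 P" "AE x in P. E s x = s' x"
      using proj_linear_span[OF cone' s] .
    have d: "(\<lambda>z. h z - s z) \<in> L2 R" using L2_diff[OF hL sL] .
    have "AE x in P. E h x - s' x = E (\<lambda>z. h z - s z) x"
      using s'(3) proj_diff[OF hL sL] by eventually_elim simp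
    then have "L2_norm P (\<lambda>x. E h x - s' x) = L2_norm P (E (\<lambda>z. h z - s z))"
      by (rule L2_norm_cong_AE) (intro L2_measurable L2_diff proj_L2 hL s' d)+
    also have "\<dots> \<le> L2_norm R (\<lambda>z. h z - s z)"
      using L2_norm_proj_le[OF d] .
    finally show "\<exists>g\<in>linear_span (tangent_cone P \<P>). L2_norm P (\<lambda>x. E h x - g x) < e"
      using s'(1) e by force
  qed
qed

end

section \<open>Uniqueness of the gradient in the tangent space\<close>

text \<open>Both gradients compute the same limit along every curve, so their difference is
  orthogonal to all tangents and to their span. It also lies in the closure of that span, hence has
  norm 0.\<close>

lemma canonical_gradientI:
  assumes grad: "is_gradient \<R> k R kt" and kt: "kt \<in> tangent_space R \<R>"
  shows "is_canonical_gradient \<R> k R kt"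
  unfolding is_canonical_gradient_def
proof (intro conjI allI impI grad kt, elim conjE)
  fix h assume grad_h: "is_gradient \<R> k R h" and h: "h \<in> tangent_space R \<R>"
  let ?d = "\<lambda>x. h x - kt x"
  have hL: "h \<in> L2 R" and kL: "kt \<in> L2 R"
    using grad grad_h by (auto simp: is_gradient_def L2_zero_def)
  then have d: "?d \<in> L2 R" by (rule L2_diff)
  have cone: "g \<in> L2 R \<and> (\<integral>x. ?d x * g x \<partial>R) = 0" if g: "g \<in> tangent_cone R \<R>" for g
  proof
    obtain S where S: "L2_differentiable_curve \<R> S g" "S 0 = R"
      using g by (auto simp: tangent_cone_def)
    then show gL: "g \<in> L2 R" by (auto simp: L2_differentiable_curve_def)
    let ?q = "\<lambda>t. (k (S t) - k (S 0)) / t"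
    have "(?q \<longlongrightarrow> (\<integral>x. h x * g x \<partial>R)) (at_right 0)" "(?q \<longlongrightarrow> (\<integral>x. kt x * g x \<partial>R)) (at_right 0)"
      using grad grad_h S unfolding is_gradient_def by blast+
    then have "(\<integral>x. h x * g x \<partial>R) = (\<integral>x. kt x * g x \<partial>R)"
      by (rule tendsto_unique[rotated]) simp
    then show "(\<integral>x. ?d x * g x \<partial>R) = 0"
      using L2_mult_integrable[OF hL gL] L2_mult_integrable[OF kL gL] by (simp add: left_diff_distrib)
  qed
  have span: "s \<in> L2 R \<and> (\<integral>x. ?d x * s x \<partial>R) = 0" if s_span: "s \<in> linear_span (tangent_cone R \<R>)" for s
  proof -
    obtain F c where F: "finite F" "F \<subseteq> tangent_cone R \<R>" and s: "s = (\<lambda>x. \<Sum>f\<in>F. c f * f x)"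
      using s_span by (auto simp: linear_span_def)
    have FL: "f \<in> L2 R" "(\<integral>x. ?d x * f x \<partial>R) = 0" if "f \<in> F" for f
      using F cone that by auto
    have "(\<integral>x. ?d x * s x \<partial>R) = (\<integral>x. (\<Sum>f\<in>F. c f * (?d x * f x)) \<partial>R)"
      unfolding s sum_distrib_left by (simp only: mult.left_commute)
    also have "\<dots> = (\<Sum>f\<in>F. \<integral>x. c f * (?d x * f x) \<partial>R)"
      by (intro Bochner_Integration.integral_sum integrable_mult_right L2_mult_integrable d FL)
    also have "\<dots> = (\<Sum>f\<in>F. c f * (\<integral>x. ?d x * f x \<partial>R))"
      by (simp only: integral_mult_right_zero)
    also have "\<dots> = 0"
      using FL by simp
    finally show ?thesis
      using FL unfolding s by (auto intro!: L2_sum L2_cmult)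
  qed
  \<comment> \<open>With \<open>h = s + u\<close> and \<open>kt = s' + v\<close>, orthogonality to
    \<open>s\<close> and \<open>s'\<close> reduces the squared norm of the difference to its inner
    product with \<open>u - v\<close>, where \<open>u\<close> and \<open>v\<close> have norm below
    \<open>e\<close>. The choice of \<open>e\<close> as half the norm then leaves only norm
    0.\<close>
  have "L2_norm R ?d < 2 * e" if e: "e > 0" for e
  proof -
    obtain s s' where s: "s \<in> linear_span (tangent_cone R \<R>)" "L2_norm R (\<lambda>x. h x - s x) < e"
      and s': "s' \<in> linear_span (tangent_cone R \<R>)" "L2_norm R (\<lambda>x. kt x - s' x) < e"
      using h kt e unfolding tangent_space_def L2_closure_def by blast
    let ?u = "\<lambda>x. h x - s x" and ?v = "\<lambda>x. kt x - s' x"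
    have uv: "?u \<in> L2 R" "?v \<in> L2 R"
      using L2_diff hL kL span s s' by blast+
    have "(L2_norm R ?d)\<^sup>2 = (\<integral>x. ?d x * (?u x - ?v x) + (?d x * s x - ?d x * s' x) \<partial>R)"
      unfolding L2_norm_square by (intro Bochner_Integration.integral_cong refl) (simp add: power2_eq_square algebra_simps)
    also have "\<dots> = (\<integral>x. ?d x * (?u x - ?v x) \<partial>R) + ((\<integral>x. ?d x * s x \<partial>R) - (\<integral>x. ?d x * s' x \<partial>R))"
      using span[OF s(1)] span[OF s'(1)]
      by (subst Bochner_Integration.integral_add Bochner_Integration.integral_diff;
          (intro Bochner_Integration.integrable_diff L2_mult_integrable d L2_diff uv; blast)?)+ simp
    also have "\<dots> = (\<integral>x. ?d x * (?u x - ?v x) \<partial>R)"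
      using span[OF s(1)] span[OF s'(1)] by simp
    also have "\<dots> \<le> L2_norm R ?d * L2_norm R (\<lambda>x. ?u x - ?v x)"
      using L2_Cauchy_Schwarz[OF d L2_diff[OF uv]] by linarith
    also have "\<dots> \<le> L2_norm R ?d * (L2_norm R ?u + L2_norm R ?v)"
      by (intro mult_left_mono L2_norm_triangle_diff uv L2_norm_nonneg)
    finally have "L2_norm R ?d * L2_norm R ?d \<le> L2_norm R ?d * (L2_norm R ?u + L2_norm R ?v)"
      by (simp only: power2_eq_square)
    then have "L2_norm R ?d \<le> L2_norm R ?u + L2_norm R ?v \<or> L2_norm R ?d = 0"
      using L2_norm_nonneg[of R ?d] by (auto simp: mult_le_cancel_left)
    then show ?thesis
      using s(2) s'(2) e by linarith
  qed
  from this[of "L2_norm R ?d / 2"] have "L2_norm R ?d = 0"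
    using L2_norm_nonneg[of R ?d] by linarith
  then have "AE x in R. ?d x = 0"
    using L2_norm_eq_0_iff[OF d] by blast
  then show "AE x in R. h x = kt x"
    by eventually_elim simp
qed

section \<open>Coordinate projections of a product measure\<close>

lemma (in prob_space) square_integral_le:
  assumes "f \<in> L2 M"
  shows "(\<integral>x. f x \<partial>M)\<^sup>2 \<le> (\<integral>x. (f x)\<^sup>2 \<partial>M)"
  using power_mono[OF abs_integral_le_L2_norm[OF assms] abs_ge_zero, of 2] by (simp add: L2_norm_square)

lemma distr_pair_snd:
  assumes "prob_space N" "prob_space M"
  shows "distr (N \<Otimes>\<^sub>M M) M snd = M"
proof -
  interpret N: prob_space N by fact
  interpret M: prob_space M by fact
  interpret pair_prob_space N M ..
  show ?thesis
  proof (rule measure_eqI)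
    fix A assume "A \<in> sets (distr (N \<Otimes>\<^sub>M M) M snd)"
    then have A: "A \<in> sets M" by simp
    have "snd -` A \<inter> space (N \<Otimes>\<^sub>M M) = space N \<times> A"
      using sets.sets_into_space[OF A] by (auto simp: space_pair_measure)
    then show "emeasure (distr (N \<Otimes>\<^sub>M M) M snd) A = emeasure M A"
      using A by (simp add: emeasure_distr M.emeasure_pair_measure_Times N.emeasure_space_1)
  qed simp
qed

text \<open>The adjunction is Fubini's theorem for \<open>h * (g \<circ> fst)\<close>. Square
  integrability of the coordinate integral comes from Jensen's inequality on almost every
  fibre.\<close>

lemma L2_projection_fst:
  assumes "prob_space P" "prob_space Q"
  shows "L2_projection (P \<Otimes>\<^sub>M Q) P fst (\<lambda>h x. \<integral>y. h (x, y) \<partial>Q)"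
proof -
  interpret P: prob_space P by fact
  interpret Q: prob_space Q by fact
  interpret PQ: pair_prob_space P Q ..
  show ?thesis
  proof
    show "distr (P \<Otimes>\<^sub>M Q) P fst = P" by (rule Q.distr_pair_fst)
    fix h assume h: "h \<in> L2 (P \<Otimes>\<^sub>M Q)"
    note [measurable] = L2_measurable[OF h]
    show "(\<lambda>x. \<integral>y. h (x, y) \<partial>Q) \<in> L2 P"
      unfolding L2_def
    proof (intro CollectI conjI)
      show "(\<lambda>x. \<integral>y. h (x, y) \<partial>Q) \<in> borel_measurable P" by measurable
      have int: "integrable P (\<lambda>x. \<integral>y. (h (x, y))\<^sup>2 \<partial>Q)"
        using PQ.integrable_fst'[OF L2_integrable_square[OF h]] .
      have "AE x in P. integrable Q (\<lambda>y. (h (x, y))\<^sup>2)"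
        using PQ.AE_integrable_fst'[OF L2_integrable_square[OF h]] .
      then have "AE x in P. (\<integral>y. h (x, y) \<partial>Q)\<^sup>2 \<le> (\<integral>y. (h (x, y))\<^sup>2 \<partial>Q)"
        using AE_space
      proof eventually_elim
        case (elim x)
        then have "(\<lambda>y. h (x, y)) \<in> L2 Q" by (simp add: L2_def)
        then show ?case by (rule Q.square_integral_le)
      qed
      then have "AE x in P. norm ((\<integral>y. h (x, y) \<partial>Q)\<^sup>2) \<le> norm (\<integral>y. (h (x, y))\<^sup>2 \<partial>Q)"
        by eventually_elim simp
      then show "integrable P (\<lambda>x. (\<integral>y. h (x, y) \<partial>Q)\<^sup>2)"
        by (rule Bochner_Integration.integrable_bound[OF int, rotated]) measurable
    qed
    fix g assume g: "g \<in> L2 P"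
    have "(\<lambda>z. g (fst z)) \<in> L2 (P \<Otimes>\<^sub>M Q)"
      using g integrable_distr_eq[of fst "P \<Otimes>\<^sub>M Q" P "\<lambda>x. (g x)\<^sup>2", unfolded Q.distr_pair_fst]
      by (auto simp: L2_def)
    from PQ.integral_fst'[OF L2_mult_integrable[OF h this]]
    show "(\<integral>z. h z * g (fst z) \<partial>(P \<Otimes>\<^sub>M Q)) = (\<integral>x. (\<integral>y. h (x, y) \<partial>Q) * g x \<partial>P)"
      by simp
  qed simp
qed

text \<open>Swapping the coordinates preserves integrals and turns this into the case of the first
  projection.\<close>

lemma L2_projection_snd:
  assumes "prob_space P" "prob_space Q"
  shows "L2_projection (P \<Otimes>\<^sub>M Q) Q snd (\<lambda>h y. \<integral>x. h (x, y) \<partial>P)"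
proof -
  interpret P: prob_space P by fact
  interpret Q: prob_space Q by fact
  interpret PQ: pair_prob_space P Q ..
  interpret QP: L2_projection "Q \<Otimes>\<^sub>M P" Q fst "\<lambda>h x. \<integral>y. h (x, y) \<partial>P"
    using assms by (intro L2_projection_fst)
  have swap: "(\<lambda>(x, y). h (y, x)) \<in> L2 (Q \<Otimes>\<^sub>M P)" if "h \<in> L2 (P \<Otimes>\<^sub>M Q)" for h
    using that measurable_pair_swap[of h P Q borel] PQ.integrable_product_swap[of "\<lambda>z. (h z)\<^sup>2"]
    by (simp add: L2_def case_prod_unfold)
  show ?thesis
  proof
    show "distr (P \<Otimes>\<^sub>M Q) Q snd = Q" using assms by (rule distr_pair_snd)
    fix h assume h: "h \<in> L2 (P \<Otimes>\<^sub>M Q)"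
    note [measurable] = L2_measurable[OF h]
    show "(\<lambda>y. \<integral>x. h (x, y) \<partial>P) \<in> L2 Q"
      using QP.proj_L2[OF swap[OF h]] by simp
    fix g assume g: "g \<in> L2 Q"
    note [measurable] = L2_measurable[OF g]
    have "(\<integral>z. h z * g (snd z) \<partial>(P \<Otimes>\<^sub>M Q)) = (\<integral>(x, y). h (y, x) * g x \<partial>(Q \<Otimes>\<^sub>M P))"
      by (subst PQ.integral_product_swap[symmetric]) simp_all
    also have "\<dots> = (\<integral>y. (\<integral>x. h (x, y) \<partial>P) * g y \<partial>Q)"
      using QP.proj_adjoint[OF swap[OF h] g] by (simp add: case_prod_unfold)
    finally show "(\<integral>z. h z * g (snd z) \<partial>(P \<Otimes>\<^sub>M Q)) = (\<integral>y. (\<integral>x. h (x, y) \<partial>P) * g y \<partial>Q)" .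
  qed simp
qed

text \<open>Functions of separate coordinates are independent, so the integral of the squared
  product factorizes. This controls the cross term \<open>(f - 1) * (h - 1)\<close> later.\<close>

lemma L2_pair_mult:
  assumes "prob_space P" "prob_space Q" and f: "f \<in> L2 P" and h: "h \<in> L2 Q"
  shows "(\<lambda>z. f (fst z) * h (snd z)) \<in> L2 (P \<Otimes>\<^sub>M Q)"
    and "L2_norm (P \<Otimes>\<^sub>M Q) (\<lambda>z. f (fst z) * h (snd z)) = L2_norm P f * L2_norm Q h"
proof -
  interpret P: prob_space P by fact
  interpret Q: prob_space Q by fact
  interpret PQ: pair_prob_space P Q ..
  note [measurable] = L2_measurable[OF f] L2_measurable[OF h]
  have int: "integrable (P \<Otimes>\<^sub>M Q) (\<lambda>z. (f (fst z) * h (snd z))\<^sup>2)"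
  proof (rule PQ.Fubini_integrable)
    show "integrable P (\<lambda>x. \<integral>y. norm ((f (fst (x, y)) * h (snd (x, y)))\<^sup>2) \<partial>Q)"
      using f by (simp add: power_mult_distrib L2_def)
    show "AE x in P. integrable Q (\<lambda>y. (f (fst (x, y)) * h (snd (x, y)))\<^sup>2)"
      using h by (simp add: power_mult_distrib L2_def)
  qed measurable
  then show "(\<lambda>z. f (fst z) * h (snd z)) \<in> L2 (P \<Otimes>\<^sub>M Q)"
    by (simp add: L2_def)
  show "L2_norm (P \<Otimes>\<^sub>M Q) (\<lambda>z. f (fst z) * h (snd z)) = L2_norm P f * L2_norm Q h"
    unfolding L2_norm_def PQ.integral_fst'[OF int, symmetric]
    by (simp add: power_mult_distrib real_sqrt_mult)
qed

section \<open>Differentiable curves of product measures\<close>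

text \<open>\<open>\<phi>\<close> pushes every lifted measure forward to the measure that it lifts.
  At \<open>t = 0\<close> this preserves the norm of the remainder, at the other \<open>t\<close>
  the mass of the set where the quotient is infinite.\<close>

lemma L2_differentiable_curve_pullback:
  assumes curve: "L2_differentiable_curve \<P> S g"
    and \<Phi>: "\<And>p. p \<in> \<P> \<Longrightarrow> \<Phi> p \<in> \<R> \<and> sets p = sets (S 0) \<and> sets (\<Phi> p) = sets (\<Phi> (S 0))
      \<and> \<phi> \<in> measurable (\<Phi> p) p \<and> distr (\<Phi> p) p \<phi> = p"
    and dq: "\<And>p L. p \<in> \<P> \<Longrightarrow> is_density_quotient p (S 0) L \<Longrightarrow>
      is_density_quotient (\<Phi> p) (\<Phi> (S 0)) (\<lambda>z. L (\<phi> z))"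
  shows "L2_differentiable_curve \<R> (\<lambda>t. \<Phi> (S t)) (\<lambda>z. g (\<phi> z))"
proof -
  obtain \<epsilon> L where \<epsilon>: "\<epsilon> > 0" and g: "g \<in> L2 (S 0)"
    and S: "\<And>t. t \<in> {-\<epsilon><..<\<epsilon>} \<Longrightarrow> S t \<in> \<P> \<and> is_density_quotient (S t) (S 0) (L t)"
    and norm: "(\<lambda>t. L2_norm (S 0) (\<lambda>x. 2 * (sqrt (enn2real (L t x)) - 1) - t * g x)) \<in> o[at 0](\<lambda>t. \<bar>t\<bar>)"
    and sing: "(\<lambda>t. measure (S t) {x \<in> space (S 0). L t x = \<infinity>}) \<in> o[at 0](\<lambda>t. t\<^sup>2)"
    using curve unfolding L2_differentiable_curve_def by blast
  have S0: "S 0 \<in> \<P>" using S[of 0] \<epsilon> by simp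
  have \<phi>: "\<phi> \<in> measurable (\<Phi> (S 0)) (S 0)" and distr: "distr (\<Phi> (S 0)) (S 0) \<phi> = S 0"
    using \<Phi>[OF S0] by blast+
  have integral: "(\<integral>z. f (\<phi> z) \<partial>\<Phi> (S 0)) = (\<integral>x. f x \<partial>S 0)" if "f \<in> borel_measurable (S 0)" for f :: "_ \<Rightarrow> real"
    using integral_distr[OF \<phi> that] unfolding distr by simp
  have ev: "\<forall>\<^sub>F t in at 0. t \<in> {-\<epsilon><..<\<epsilon>}"
    using \<epsilon> by (intro eventually_at_in_open') auto
  have L_measurable: "L t \<in> borel_measurable (S 0)" if "t \<in> {-\<epsilon><..<\<epsilon>}" for t
    using S[OF that] by (simp add: is_density_quotient_def)
  show ?thesis
    unfolding L2_differentiable_curve_def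
  proof (intro conjI exI[of _ \<epsilon>] exI[of _ "\<lambda>t z. L t (\<phi> z)"] ballI \<epsilon>)
    have "integrable (\<Phi> (S 0)) (\<lambda>z. (g (\<phi> z))\<^sup>2)"
      using integrable_distr[OF \<phi>, of "\<lambda>x. (g x)\<^sup>2"] g unfolding distr by (simp add: L2_def)
    then show "(\<lambda>z. g (\<phi> z)) \<in> L2 (\<Phi> (S 0))"
      using measurable_compose[OF \<phi> L2_measurable[OF g]] by (simp add: L2_def)
    show "(\<lambda>t. L2_norm (\<Phi> (S 0)) (\<lambda>z. 2 * (sqrt (enn2real (L t (\<phi> z))) - 1) - t * g (\<phi> z))) \<in> o[at 0](\<lambda>t. \<bar>t\<bar>)"
    proof (rule landau_o.small.in_cong[THEN iffD2, OF _ norm])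
      show "\<forall>\<^sub>F t in at 0. L2_norm (\<Phi> (S 0)) (\<lambda>z. 2 * (sqrt (enn2real (L t (\<phi> z))) - 1) - t * g (\<phi> z))
          = L2_norm (S 0) (\<lambda>x. 2 * (sqrt (enn2real (L t x)) - 1) - t * g x)"
        using ev
      proof eventually_elim
        case (elim t)
        note [measurable] = L_measurable[OF elim] L2_measurable[OF g]
        show ?case
          unfolding L2_norm_def
          by (subst integral[where f = "\<lambda>x. (2 * (sqrt (enn2real (L t x)) - 1) - t * g x)\<^sup>2"]) simp_all
      qed
    qed
    show "(\<lambda>t. measure (\<Phi> (S t)) {z \<in> space (\<Phi> (S 0)). L t (\<phi> z) = \<infinity>}) \<in> o[at 0](\<lambda>t. t\<^sup>2)"
    proof (rule landau_o.small.in_cong[THEN iffD2, OF _ sing])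
      show "\<forall>\<^sub>F t in at 0. measure (\<Phi> (S t)) {z \<in> space (\<Phi> (S 0)). L t (\<phi> z) = \<infinity>}
          = measure (S t) {x \<in> space (S 0). L t x = \<infinity>}"
        using ev
      proof eventually_elim
        case (elim t)
        note St = S[OF elim, THEN conjunct1]
        note [measurable] = L_measurable[OF elim]
        have "sets (\<Phi> (S t)) = sets (\<Phi> (S 0))" and sets: "sets (S t) = sets (S 0)"
          using \<Phi>[OF St] by blast+
        then have sp: "space (\<Phi> (S t)) = space (\<Phi> (S 0))"
          by (intro sets_eq_imp_space_eq)
        have "{x \<in> space (S 0). L t x = \<infinity>} \<in> sets (S t)"
          unfolding sets by measurable
        then have "measure (distr (\<Phi> (S t)) (S t) \<phi>) {x \<in> space (S 0). L t x = \<infinity>}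
            = measure (\<Phi> (S t)) (\<phi> -` {x \<in> space (S 0). L t x = \<infinity>} \<inter> space (\<Phi> (S t)))"
          using \<Phi>[OF St] by (intro measure_distr) auto
        also have "distr (\<Phi> (S t)) (S t) \<phi> = S t"
          using \<Phi>[OF St] by blast
        also have "\<phi> -` {x \<in> space (S 0). L t x = \<infinity>} \<inter> space (\<Phi> (S t)) = {z \<in> space (\<Phi> (S 0)). L t (\<phi> z) = \<infinity>}"
          unfolding sp using measurable_space[OF \<phi>] by auto
        finally show ?case by (rule sym)
      qed
    qed
  qed (use S \<Phi> dq in blast)+
qed

lemma L2_differentiable_curve_pair_left:
  assumes \<P>: "\<P> \<subseteq> space (prob_algebra M1)" and Q0: "prob_space Q0" "Q0 \<in> \<Q>"
    and curve: "L2_differentiable_curve \<P> S g"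
  shows "L2_differentiable_curve (product_family \<P> \<Q>) (\<lambda>t. S t \<Otimes>\<^sub>M Q0) (\<lambda>z. g (fst z))"
proof (rule L2_differentiable_curve_pullback[OF curve])
  interpret Q0: prob_space Q0 by fact
  have S0: "S 0 \<in> \<P>" using curve by (fastforce simp: L2_differentiable_curve_def)
  have prob: "prob_space p \<and> sets p = sets M1" if "p \<in> \<P>" for p
    using that \<P> by (auto simp: space_prob_algebra)
  fix p assume p: "p \<in> \<P>"
  have sets: "sets p = sets (S 0)" using prob[OF p] prob[OF S0] by simp
  moreover have "sets (p \<Otimes>\<^sub>M Q0) = sets (S 0 \<Otimes>\<^sub>M Q0)"
    by (intro sets_pair_measure_cong sets refl)
  moreover have "p \<Otimes>\<^sub>M Q0 \<in> product_family \<P> \<Q>"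
    using p Q0(2) by (auto simp: product_family_def)
  ultimately show "p \<Otimes>\<^sub>M Q0 \<in> product_family \<P> \<Q> \<and> sets p = sets (S 0)
      \<and> sets (p \<Otimes>\<^sub>M Q0) = sets (S 0 \<Otimes>\<^sub>M Q0)
      \<and> fst \<in> measurable (p \<Otimes>\<^sub>M Q0) p \<and> distr (p \<Otimes>\<^sub>M Q0) p fst = p"
    using Q0.distr_pair_fst by simp
  fix L assume L: "is_density_quotient p (S 0) L"
  \<comment> \<open>The constant factor contributes the quotient 1 of \<open>Q0\<close> by itself,
    for which the case distinction of the product formula collapses.\<close>
  have "(\<lambda>z. if L (fst z) = \<infinity> \<or> (1::ennreal) = \<infinity> then \<infinity> else L (fst z) * 1) = (\<lambda>z. L (fst z))"
    by (auto simp: fun_eq_iff)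
  with density_quotient_pair[OF conjunct1[OF prob[OF p]] conjunct1[OF prob[OF S0]] Q0(1) Q0(1) sets refl
      L density_quotient_self[OF Q0(1)]]
  show "is_density_quotient (p \<Otimes>\<^sub>M Q0) (S 0 \<Otimes>\<^sub>M Q0) (\<lambda>z. L (fst z))"
    by (rule back_subst[of "is_density_quotient _ _"])
qed

lemma L2_differentiable_curve_pair_right:
  assumes \<Q>: "\<Q> \<subseteq> space (prob_algebra M2)" and P0: "prob_space P0" "P0 \<in> \<P>"
    and curve: "L2_differentiable_curve \<Q> S g"
  shows "L2_differentiable_curve (product_family \<P> \<Q>) (\<lambda>t. P0 \<Otimes>\<^sub>M S t) (\<lambda>z. g (snd z))"
proof (rule L2_differentiable_curve_pullback[OF curve])
  have S0: "S 0 \<in> \<Q>" using curve by (fastforce simp: L2_differentiable_curve_def)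
  have prob: "prob_space q \<and> sets q = sets M2" if "q \<in> \<Q>" for q
    using that \<Q> by (auto simp: space_prob_algebra)
  fix q assume q: "q \<in> \<Q>"
  have sets: "sets q = sets (S 0)" using prob[OF q] prob[OF S0] by simp
  moreover have "sets (P0 \<Otimes>\<^sub>M q) = sets (P0 \<Otimes>\<^sub>M S 0)"
    by (intro sets_pair_measure_cong sets refl)
  moreover have "P0 \<Otimes>\<^sub>M q \<in> product_family \<P> \<Q>"
    using q P0(2) by (auto simp: product_family_def)
  ultimately show "P0 \<Otimes>\<^sub>M q \<in> product_family \<P> \<Q> \<and> sets q = sets (S 0)
      \<and> sets (P0 \<Otimes>\<^sub>M q) = sets (P0 \<Otimes>\<^sub>M S 0)
      \<and> snd \<in> measurable (P0 \<Otimes>\<^sub>M q) q \<and> distr (P0 \<Otimes>\<^sub>M q) q snd = q"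
    using distr_pair_snd[OF P0(1) conjunct1[OF prob[OF q]]] by simp
  fix L assume L: "is_density_quotient q (S 0) L"
  have "(\<lambda>z. if (1::ennreal) = \<infinity> \<or> L (snd z) = \<infinity> then \<infinity> else 1 * L (snd z)) = (\<lambda>z. L (snd z))"
    by (auto simp: fun_eq_iff)
  with density_quotient_pair[OF P0(1) P0(1) conjunct1[OF prob[OF q]] conjunct1[OF prob[OF S0]] refl sets
      density_quotient_self[OF P0(1)] L]
  show "is_density_quotient (P0 \<Otimes>\<^sub>M q) (P0 \<Otimes>\<^sub>M S 0) (\<lambda>z. L (snd z))"
    by (rule back_subst[of "is_density_quotient _ _"])
qed

section \<open>From a curve of products to curves of the factors\<close>

text \<open>On a null set the absolutely continuous part vanishes, so only the singular part can
  charge it. This bounds the singular mass of a marginal by that of the product.\<close>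

lemma density_quotient_null_set_le:
  assumes dq: "is_density_quotient S R L" and sets: "sets S = sets R" and N: "N \<in> null_sets R"
  shows "emeasure S N \<le> emeasure S {z \<in> space R. L z = \<infinity>}"
proof -
  have [measurable]: "L \<in> borel_measurable R"
    and "emeasure S N = (\<integral>\<^sup>+z\<in>N. L z \<partial>R) + emeasure S (N \<inter> {z \<in> space R. L z = \<infinity>})"
    using dq null_setsD2[OF N] unfolding is_density_quotient_def by blast+
  note this(2)
  also have "(\<integral>\<^sup>+z\<in>N. L z \<partial>R) = 0"
    by (rule nn_integral_null_set[OF N])
  also have "0 + emeasure S (N \<inter> {z \<in> space R. L z = \<infinity>}) \<le> emeasure S {z \<in> space R. L z = \<infinity>}"
  proof -
    have "{z \<in> space R. L z = \<infinity>} \<in> sets S"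
      unfolding sets by measurable
    then show ?thesis by (auto intro: emeasure_mono)
  qed
  finally show ?thesis .
qed

context L2_projection
begin

text \<open>If \<open>u\<close> projects to \<open>c * f\<close>, then \<open>2 * (u - 1) - t * g\<close> projects to
  \<open>2 * (f - 1) - t * E g\<close> up to the error \<open>2 * (1 - c) * f\<close>.\<close>

lemma L2_norm_root_proj_le:
  assumes u: "u \<in> L2 R" and g: "g \<in> L2 R" and f: "f \<in> L2 P" and f_le: "L2_norm P f \<le> 1"
    and Eu: "AE x in P. E u x = c * f x" and c: "c \<le> 1"
    and c_le: "2 * (1 - c) \<le> L2_norm R (\<lambda>z. 2 * (u z - 1) - t * g z)" (is "_ \<le> ?\<rho>")
  shows "L2_norm P (\<lambda>x. 2 * (f x - 1) - t * E g x) \<le> 2 * ?\<rho>"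
proof -
  interpret R: prob_space R by (rule prob_R)
  interpret P: prob_space P by (rule prob_P)
  let ?r = "\<lambda>z. 2 * (u z - 1) - t * g z"
  have r: "?r \<in> L2 R"
    by (intro L2_diff L2_cmult u g R.L2_const)
  \<comment> \<open>The remainder is written as a combination of \<open>u\<close>, 1 and
    \<open>g\<close> with coefficients 2, -2 and \<open>-t\<close>, so that \<open>proj_sum\<close>
    projects it in one go.\<close>
  let ?F = "\<lambda>i. if i = 0 then u else if i = 1 then \<lambda>_. 1 else g"
  let ?c = "\<lambda>i. if i = 0 then 2 else if i = 1 then -2 else -t"
  have "?r = (\<lambda>z. \<Sum>i<3::nat. ?c i * ?F i z)"
    by (simp add: numeral_3_eq_3 fun_eq_iff)
  moreover have "AE x in P. E (\<lambda>z. \<Sum>i<3::nat. ?c i * ?F i z) x = (\<Sum>i<3::nat. ?c i * E (?F i) x)"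
    by (rule proj_sum) (use u g R.L2_const in auto)
  ultimately have "AE x in P. E ?r x = (\<Sum>i<3::nat. ?c i * E (?F i) x)"
    by (simp only:)
  moreover have "AE x in P. E (\<lambda>_. 1) x = 1"
    using proj_pullback[OF P.L2_const[of 1]] .
  ultimately have "AE x in P. 2 * (f x - 1) - t * E g x = E ?r x + 2 * (1 - c) * f x"
    using Eu by eventually_elim (simp add: numeral_3_eq_3 algebra_simps)
  then have "L2_norm P (\<lambda>x. 2 * (f x - 1) - t * E g x) = L2_norm P (\<lambda>x. E ?r x + 2 * (1 - c) * f x)"
    by (rule L2_norm_cong_AE) (intro L2_measurable L2_diff L2_add L2_cmult f P.L2_const proj_L2 g r)+
  also have "\<dots> \<le> L2_norm P (E ?r) + L2_norm P (\<lambda>x. 2 * (1 - c) * f x)"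
    by (intro L2_norm_triangle L2_cmult f proj_L2 r)
  \<comment> \<open>One \<open>?\<rho>\<close> comes from contractivity, the other from
    \<open>c_le\<close>; together they give the factor 2.\<close>
  also have "\<dots> \<le> ?\<rho> + 2 * (1 - c) * 1"
    unfolding L2_norm_cmult using c f_le by (intro add_mono L2_norm_proj_le r mult_mono L2_norm_nonneg) auto
  finally show ?thesis using c_le by linarith
qed

text \<open>\<open>T t\<close> is the marginal of \<open>S t\<close>, and the norm condition is
  inherited through \<open>norm_le\<close>. For the singular masses, the set where
  \<open>K t\<close> is infinite is \<open>P\<close>-null, so its preimage is \<open>R\<close>-null
  and is charged by the singular part of \<open>S t\<close> alone.\<close>

lemma L2_differentiable_curve_proj:
  assumes \<epsilon>: "\<epsilon> > 0" and g: "g \<in> L2 R"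
    and dq: "\<And>t. t \<in> {-\<epsilon><..<\<epsilon>} \<Longrightarrow> is_density_quotient (S t) R (L t)"
    and sing: "(\<lambda>t. measure (S t) {z \<in> space R. L t z = \<infinity>}) \<in> o[at 0](\<lambda>t. t\<^sup>2)"
    and S: "\<And>t. t \<in> {-\<epsilon><..<\<epsilon>} \<Longrightarrow> prob_space (S t) \<and> sets (S t) = sets R"
    and T0: "T 0 = P"
    and T: "\<And>t. t \<in> {-\<epsilon><..<\<epsilon>} \<Longrightarrow> T t \<in> \<P> \<and> distr (S t) P \<phi> = T t \<and> is_density_quotient (T t) P (K t)"
    and norm_le: "\<And>t. t \<in> {-\<epsilon><..<\<epsilon>} \<Longrightarrow>
      L2_norm P (\<lambda>x. 2 * (sqrt (enn2real (K t x)) - 1) - t * E g x) \<le> C * \<rho> t"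
    and \<rho>: "\<rho> \<in> o[at 0](\<lambda>t. \<bar>t\<bar>)"
  shows "L2_differentiable_curve \<P> T (E g)"
proof -
  have ev: "\<forall>\<^sub>F t in at 0. t \<in> {-\<epsilon><..<\<epsilon>}"
    using \<epsilon> by (intro eventually_at_in_open') auto
  have "(\<lambda>t. C * \<rho> t) \<in> o[at 0](\<lambda>t. \<bar>t\<bar>)"
    using \<rho> by (cases "C = 0") simp_all
  then have norm: "(\<lambda>t. L2_norm P (\<lambda>x. 2 * (sqrt (enn2real (K t x)) - 1) - t * E g x)) \<in> o[at 0](\<lambda>t. \<bar>t\<bar>)"
  proof (rule landau_o.big_small_trans[rotated])
    show "(\<lambda>t. L2_norm P (\<lambda>x. 2 * (sqrt (enn2real (K t x)) - 1) - t * E g x)) \<in> O[at 0](\<lambda>t. C * \<rho> t)"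
    proof (rule bigoI[of _ 1])
      show "\<forall>\<^sub>F t in at 0. norm (L2_norm P (\<lambda>x. 2 * (sqrt (enn2real (K t x)) - 1) - t * E g x)) \<le> 1 * norm (C * \<rho> t)"
        using ev
      proof eventually_elim
        case (elim t)
        show ?case
          using norm_le[OF elim] L2_norm_nonneg[of P "\<lambda>x. 2 * (sqrt (enn2real (K t x)) - 1) - t * E g x"]
          by simp
      qed
    qed
  qed
  have "(\<lambda>t. measure (T t) {x \<in> space P. K t x = \<infinity>}) \<in> o[at 0](\<lambda>t. t\<^sup>2)"
    using sing
  proof (rule landau_o.big_small_trans[rotated])
    show "(\<lambda>t. measure (T t) {x \<in> space P. K t x = \<infinity>}) \<in> O[at 0](\<lambda>t. measure (S t) {z \<in> space R. L t z = \<infinity>})"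
    proof (rule bigoI[of _ 1])
      show "\<forall>\<^sub>F t in at 0. norm (measure (T t) {x \<in> space P. K t x = \<infinity>})
          \<le> 1 * norm (measure (S t) {z \<in> space R. L t z = \<infinity>})"
        using ev
      proof eventually_elim
        case (elim t)
        interpret S: prob_space "S t" using S[OF elim] by blast
        have sets: "sets (S t) = sets R" using S[OF elim] by blast
        have Tt: "distr (S t) P \<phi> = T t" and K: "is_density_quotient (T t) P (K t)"
          using T[OF elim] by blast+
        interpret P: prob_space P by (rule prob_P)
        have [measurable]: "K t \<in> borel_measurable P"
          using K by (simp add: is_density_quotient_def)
        have "AE x in P. K t x < \<infinity>"
          by (subst P.AE_iff_emeasure_eq_1) (use K in \<open>simp_all add: is_density_quotient_def\<close>)
        then have "AE x in P. K t x \<noteq> \<infinity>"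
          by eventually_elim simp
        then have null: "{x \<in> space P. K t x = \<infinity>} \<in> null_sets P"
          by (subst (asm) AE_iff_null) simp_all
        have "\<phi> \<in> measurable (S t) P"
          using proj_measurable by (simp add: measurable_cong_sets[OF sets refl])
        then have "emeasure (T t) {x \<in> space P. K t x = \<infinity>}
            = emeasure (S t) (\<phi> -` {x \<in> space P. K t x = \<infinity>} \<inter> space R)"
          unfolding Tt[symmetric] by (subst emeasure_distr) (simp_all add: sets_eq_imp_space_eq[OF sets])
        also have "\<dots> \<le> emeasure (S t) {z \<in> space R. L t z = \<infinity>}"
        proof (rule density_quotient_null_set_le[OF dq[OF elim] sets])
          have "{x \<in> space P. K t x = \<infinity>} \<in> null_sets (distr R P \<phi>)"
            unfolding distr_proj by (rule null)
          then show "\<phi> -` {x \<in> space P. K t x = \<infinity>} \<inter> space R \<in> null_sets R"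
            by (subst (asm) null_sets_distr_iff) simp_all
        qed
        finally have "measure (T t) {x \<in> space P. K t x = \<infinity>} \<le> measure (S t) {z \<in> space R. L t z = \<infinity>}"
          unfolding measure_def by (rule enn2real_mono) (simp add: S.emeasure_eq_measure)
        then show ?case by simp
      qed
    qed
  qed
  with \<epsilon> T norm show ?thesis
    unfolding L2_differentiable_curve_def T0 using proj_L2[OF g] by blast
qed

end

text \<open>For fixed \<open>t\<close>, the integral of the remainder is
  \<open>2 * (a * b - 1) - t * m\<close>, of absolute value at most \<open>\<rho>\<close>, with
  \<open>a\<close> and \<open>b\<close> the means of \<open>h\<close> and \<open>f\<close>. As
  \<open>a * b \<le> 1\<close>, the first bound follows; for \<open>m = 0\<close> it also follows
  that \<open>2 * (1 - a)\<close> and \<open>2 * (1 - b)\<close> are at most \<open>\<rho>\<close>,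
  as the projection lemma requires.\<close>

lemma pair_root_bounds:
  fixes f :: "'a \<Rightarrow> real" and h :: "'b \<Rightarrow> real" and g :: "'a \<times> 'b \<Rightarrow> real" and t :: real
  assumes "prob_space P" "prob_space Q"
    and f: "f \<in> L2 P" "L2_norm P f \<le> 1" "\<And>x. 0 \<le> f x"
    and h: "h \<in> L2 Q" "L2_norm Q h \<le> 1" "\<And>y. 0 \<le> h y"
    and g: "g \<in> L2 (P \<Otimes>\<^sub>M Q)"
  defines "m \<equiv> \<integral>z. g z \<partial>(P \<Otimes>\<^sub>M Q)"
    and "g1 \<equiv> \<lambda>x. \<integral>y. g (x, y) \<partial>Q" and "g2 \<equiv> \<lambda>y. \<integral>x. g (x, y) \<partial>P"
    and "\<rho> \<equiv> L2_norm (P \<Otimes>\<^sub>M Q) (\<lambda>z. 2 * (f (fst z) * h (snd z) - 1) - t * g z)"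
  shows "t * m \<le> \<rho>"
    and "m = 0 \<Longrightarrow> L2_norm P (\<lambda>x. 2 * (f x - 1) - t * g1 x) \<le> 2 * \<rho>"
    and "m = 0 \<Longrightarrow> L2_norm Q (\<lambda>y. 2 * (h y - 1) - t * g2 y) \<le> 2 * \<rho>"
    and "m = 0 \<Longrightarrow> \<bar>t\<bar> * L2_norm (P \<Otimes>\<^sub>M Q) (\<lambda>z. g z - (g1 (fst z) + g2 (snd z)))
      \<le> 5 * \<rho> + (2 * \<rho> + \<bar>t\<bar> * L2_norm P g1) * (2 * \<rho> + \<bar>t\<bar> * L2_norm Q g2) / 2"
proof -
  interpret P: prob_space P by fact
  interpret Q: prob_space Q by fact
  interpret PQ: pair_prob_space P Q ..
  let ?R = "P \<Otimes>\<^sub>M Q"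
  interpret E1: L2_projection ?R P fst "\<lambda>h x. \<integral>y. h (x, y) \<partial>Q"
    by (rule L2_projection_fst) fact+
  interpret E2: L2_projection ?R Q snd "\<lambda>h y. \<integral>x. h (x, y) \<partial>P"
    by (rule L2_projection_snd) fact+
  let ?u = "\<lambda>z. f (fst z) * h (snd z)"
  have u: "?u \<in> L2 ?R"
    by (rule L2_pair_mult) fact+
  define a where "a = (\<integral>y. h y \<partial>Q)"
  define b where "b = (\<integral>x. f x \<partial>P)"
  have a: "0 \<le> a" "a \<le> 1"
    using Q.abs_integral_le_L2_norm[OF h(1)] h(2,3) by (auto simp: a_def)
  have b: "0 \<le> b" "b \<le> 1"
    using P.abs_integral_le_L2_norm[OF f(1)] f(2,3) by (auto simp: b_def)
  have int_u: "(\<integral>z. ?u z \<partial>?R) = a * b"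
    using PQ.integral_fst'[OF PQ.L2_integrable[OF u], symmetric] by (simp add: a_def b_def)
  have g1: "g1 \<in> L2 P" and g2: "g2 \<in> L2 Q"
    unfolding g1_def g2_def by (intro E1.proj_L2 E2.proj_L2 g)+
  let ?r = "\<lambda>z. 2 * (?u z - 1) - t * g z"
  have r: "?r \<in> L2 ?R"
    by (intro L2_diff L2_cmult u g PQ.L2_const)
  have "(\<integral>z. ?r z \<partial>?R) = 2 * (a * b - 1) - t * m"
    using PQ.L2_integrable[OF u] PQ.L2_integrable[OF g] int_u by (simp add: m_def PQ.prob_space)
  then have ab: "\<bar>2 * (a * b - 1) - t * m\<bar> \<le> \<rho>"
    using PQ.abs_integral_le_L2_norm[OF r] by (simp add: \<rho>_def)
  have ab_le: "a * b \<le> a" "a * b \<le> b"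
    using a b by (simp_all add: mult_left_le mult_left_le_one_le)
  then show "t * m \<le> \<rho>"
    using ab[unfolded abs_le_iff] a by argo
  assume m: "m = 0"
  have "2 * (1 - a) \<le> \<rho>" "2 * (1 - b) \<le> \<rho>"
    using ab m ab_le by auto
  then show f_le: "L2_norm P (\<lambda>x. 2 * (f x - 1) - t * g1 x) \<le> 2 * \<rho>"
    and h_le: "L2_norm Q (\<lambda>y. 2 * (h y - 1) - t * g2 y) \<le> 2 * \<rho>"
    unfolding \<rho>_def g1_def g2_def
    by (intro E1.L2_norm_root_proj_le[where c = a] E2.L2_norm_root_proj_le[where c = b] u g f h a b AE_I2;
        simp add: a_def b_def)+
  have diff: "(\<lambda>x. f x - 1) \<in> L2 P" "(\<lambda>y. h y - 1) \<in> L2 Q"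
    by (intro L2_diff f h P.L2_const Q.L2_const)+
  have d1: "(\<lambda>x. 2 * (f x - 1) - t * g1 x) \<in> L2 P" and d2: "(\<lambda>y. 2 * (h y - 1) - t * g2 y) \<in> L2 Q"
    by (intro L2_diff L2_cmult diff g1 g2)+
  have f1: "2 * L2_norm P (\<lambda>x. f x - 1) \<le> 2 * \<rho> + \<bar>t\<bar> * L2_norm P g1"
    using L2_norm_triangle[OF d1 L2_cmult[OF g1, of t]] f_le L2_norm_cmult[of P 2 "\<lambda>x. f x - 1"]
    by (simp add: L2_norm_cmult)
  have h1: "2 * L2_norm Q (\<lambda>y. h y - 1) \<le> 2 * \<rho> + \<bar>t\<bar> * L2_norm Q g2"
    using L2_norm_triangle[OF d2 L2_cmult[OF g2, of t]] h_le L2_norm_cmult[of Q 2 "\<lambda>y. h y - 1"]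
    by (simp add: L2_norm_cmult)
  let ?w = "\<lambda>z. (f (fst z) - 1) * (h (snd z) - 1)"
  have w: "?w \<in> L2 ?R" and w_norm: "L2_norm ?R ?w = L2_norm P (\<lambda>x. f x - 1) * L2_norm Q (\<lambda>y. h y - 1)"
    using L2_pair_mult[OF assms(1,2) diff] by blast+
  let ?s1 = "\<lambda>z. 2 * (f (fst z) - 1) - t * g1 (fst z)" and ?s2 = "\<lambda>z. 2 * (h (snd z) - 1) - t * g2 (snd z)"
  have s: "?s1 \<in> L2 ?R" "?s2 \<in> L2 ?R"
    using E1.pullback_L2[OF d1] E2.pullback_L2[OF d2] by blast+
  have s_norm: "L2_norm ?R ?s1 \<le> 2 * \<rho>" "L2_norm ?R ?s2 \<le> 2 * \<rho>"
    using E1.L2_norm_pullback[OF L2_measurable[OF d1]] E2.L2_norm_pullback[OF L2_measurable[OF d2]] f_le h_le by auto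
  have "\<bar>t\<bar> * L2_norm ?R (\<lambda>z. g z - (g1 (fst z) + g2 (snd z)))
      = L2_norm ?R (\<lambda>z. t * (g z - (g1 (fst z) + g2 (snd z))))"
    by (rule L2_norm_cmult[symmetric])
  \<comment> \<open>Expansion of \<open>f * h - 1\<close> about 1 in both factors. The final
    constant 5 is 1 for \<open>?r\<close> and 2 each for \<open>?s1\<close> and \<open>?s2\<close>;
    the quadratic term bounds \<open>2 * ?w\<close>.\<close>
  also have "\<dots> = L2_norm ?R (\<lambda>z. (?s1 z + ?s2 z + 2 * ?w z) - ?r z)"
    by (rule arg_cong[where f = "L2_norm ?R"]) (simp add: fun_eq_iff algebra_simps)
  also have "\<dots> \<le> L2_norm ?R (\<lambda>z. ?s1 z + ?s2 z + 2 * ?w z) + L2_norm ?R ?r"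
    by (intro L2_norm_triangle_diff L2_add L2_cmult s w r)
  also have "L2_norm ?R (\<lambda>z. ?s1 z + ?s2 z + 2 * ?w z) \<le> L2_norm ?R (\<lambda>z. ?s1 z + ?s2 z) + L2_norm ?R (\<lambda>z. 2 * ?w z)"
    by (intro L2_norm_triangle L2_add L2_cmult s w)
  also have "L2_norm ?R (\<lambda>z. ?s1 z + ?s2 z) \<le> L2_norm ?R ?s1 + L2_norm ?R ?s2"
    by (intro L2_norm_triangle s)
  also have "L2_norm ?R (\<lambda>z. 2 * ?w z) = (2 * L2_norm P (\<lambda>x. f x - 1)) * (2 * L2_norm Q (\<lambda>y. h y - 1)) / 2"
    unfolding L2_norm_cmult w_norm by simp
  also have "\<dots> \<le> (2 * \<rho> + \<bar>t\<bar> * L2_norm P g1) * (2 * \<rho> + \<bar>t\<bar> * L2_norm Q g2) / 2"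
    by (intro divide_right_mono mult_mono f1 h1)
       (auto intro!: add_nonneg_nonneg mult_nonneg_nonneg L2_norm_nonneg simp: \<rho>_def)
  finally show "\<bar>t\<bar> * L2_norm ?R (\<lambda>z. g z - (g1 (fst z) + g2 (snd z)))
      \<le> 5 * \<rho> + (2 * \<rho> + \<bar>t\<bar> * L2_norm P g1) * (2 * \<rho> + \<bar>t\<bar> * L2_norm Q g2) / 2"
    using s_norm by (simp add: \<rho>_def)
qed

lemma smallo_abs_eventually_le:
  assumes "\<rho> \<in> o[at 0](\<lambda>t::real. \<bar>t\<bar>)" and "c > 0"
  shows "\<forall>\<^sub>F t in at 0. \<bar>\<rho> t\<bar> \<le> c * \<bar>t\<bar>"
  using landau_o.smallD[OF assms] by simp

text \<open>The bound is one-sided but holds for both signs of \<open>t\<close>. For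
  \<open>t\<close> of the sign of \<open>m\<close> the left side is
  \<open>\<bar>t\<bar> * \<bar>m\<bar>\<close>, which is not of smaller order unless
  \<open>m = 0\<close>.\<close>

lemma smallo_abs_linear_le_imp_eq_0:
  assumes \<rho>: "\<rho> \<in> o[at 0](\<lambda>t::real. \<bar>t\<bar>)" and le: "\<forall>\<^sub>F t in at 0. t * m \<le> \<rho> t"
  shows "m = 0"
proof (rule ccontr)
  assume m: "m \<noteq> 0"
  then have "\<forall>\<^sub>F t in at 0. \<bar>\<rho> t\<bar> \<le> \<bar>m\<bar> / 2 * \<bar>t\<bar>"
    by (intro smallo_abs_eventually_le[OF \<rho>]) simp
  with le have "\<forall>\<^sub>F t in at 0. t * m \<le> \<bar>m\<bar> / 2 * \<bar>t\<bar>"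
    by eventually_elim linarith
  then obtain d where d: "d > 0" "\<And>t. t \<noteq> 0 \<Longrightarrow> \<bar>t\<bar> < d \<Longrightarrow> t * m \<le> \<bar>m\<bar> / 2 * \<bar>t\<bar>"
    by (auto simp: eventually_at)
  have "d / 2 * \<bar>m\<bar> \<le> \<bar>m\<bar> / 2 * (d / 2)"
    using d(2)[of "sgn m * (d / 2)"] d(1) m by (cases "m > 0") (auto simp: sgn_if abs_if)
  then show False
    using m d(1) by (simp add: field_simps)
qed

text \<open>Near 0 both \<open>\<rho> t \<le> c * \<bar>t\<bar>\<close> and
  \<open>\<bar>t\<bar> \<le> c\<close> hold; dividing by \<open>\<bar>t\<bar>\<close> bounds
  \<open>G\<close> by a multiple of \<open>c\<close>, and \<open>c\<close> tends to 0.\<close>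

lemma smallo_abs_quadratic_le_imp_eq_0:
  assumes \<rho>: "\<rho> \<in> o[at 0](\<lambda>t::real. \<bar>t\<bar>)" and \<rho>_nonneg: "\<And>t. 0 \<le> \<rho> t"
    and nonneg: "0 \<le> A" "0 \<le> B" "0 \<le> G"
    and le: "\<forall>\<^sub>F t in at 0. \<bar>t\<bar> * G \<le> 5 * \<rho> t + (2 * \<rho> t + \<bar>t\<bar> * A) * (2 * \<rho> t + \<bar>t\<bar> * B) / 2"
  shows "G = 0"
proof -
  have G_le: "G \<le> 5 * c + c * ((2 + A) * (2 + B) / 2)" if c: "0 < c" "c \<le> 1" for c
  proof -
    have "\<forall>\<^sub>F t in at 0. \<bar>t\<bar> \<le> c"
      using c by (auto simp: eventually_at intro!: exI[of _ c])
    moreover have "\<forall>\<^sub>F t in at (0::real). t \<noteq> 0"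
      by (simp add: eventually_at_filter)
    ultimately have "\<forall>\<^sub>F t in at (0::real). G \<le> 5 * c + c * ((2 + A) * (2 + B) / 2)"
      using smallo_abs_eventually_le[OF \<rho> c(1)] le
    proof eventually_elim
      case (elim t)
      have \<rho>t: "\<rho> t \<le> c * \<bar>t\<bar>" using elim(3) by linarith
      have "c * \<bar>t\<bar> \<le> \<bar>t\<bar>" using c by (simp add: mult_left_le_one_le)
      then have "2 * \<rho> t + \<bar>t\<bar> * A \<le> \<bar>t\<bar> * (2 + A)" "2 * \<rho> t + \<bar>t\<bar> * B \<le> \<bar>t\<bar> * (2 + B)"
        using \<rho>t by (simp_all add: algebra_simps)
      then have "(2 * \<rho> t + \<bar>t\<bar> * A) * (2 * \<rho> t + \<bar>t\<bar> * B) \<le> (\<bar>t\<bar> * (2 + A)) * (\<bar>t\<bar> * (2 + B))"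
        using nonneg \<rho>_nonneg[of t] by (intro mult_mono) auto
      also have "\<dots> = \<bar>t\<bar> * (\<bar>t\<bar> * ((2 + A) * (2 + B)))"
        by (simp add: algebra_simps)
      also have "\<dots> \<le> \<bar>t\<bar> * (c * ((2 + A) * (2 + B)))"
        using elim(1) nonneg by (intro mult_left_mono mult_right_mono) auto
      finally have "\<bar>t\<bar> * G \<le> 5 * (c * \<bar>t\<bar>) + \<bar>t\<bar> * (c * ((2 + A) * (2 + B))) / 2"
        using elim(4) \<rho>t by linarith
      also have "\<dots> = \<bar>t\<bar> * (5 * c + c * ((2 + A) * (2 + B) / 2))"
        by (simp add: algebra_simps)
      finally show ?case
        using elim(2) by (simp add: mult_le_cancel_left)
    qed
    then show ?thesis by (simp add: eventually_const)
  qed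
  have "((\<lambda>c. 5 * c + c * ((2 + A) * (2 + B) / 2)) \<longlongrightarrow> 5 * 0 + 0 * ((2 + A) * (2 + B) / 2)) (at_right 0)"
    by (intro tendsto_intros)
  moreover have "\<forall>\<^sub>F c in at_right 0. G \<le> 5 * c + c * ((2 + A) * (2 + B) / 2)"
    by (intro eventually_at_rightI[of 0 1] G_le) auto
  ultimately have "G \<le> 5 * 0 + 0 * ((2 + A) * (2 + B) / 2)"
    by (intro tendsto_lowerbound) auto
  then show ?thesis using nonneg by simp
qed

text \<open>The affinities \<open>a = \<integral>h\<close> and \<open>b = \<integral>f\<close> of the square roots of the density quotients of
  the factors are at most 1, so that integrating the expansion of \<open>f * h\<close> for positive and for
  negative \<open>t\<close> gives \<open>\<integral>g = 0\<close> and \<open>1 - a * b = o(t)\<close>. Hence integrating the expansion over one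
  coordinate only gives the expansion of the other square root.\<close>

proposition tangent_cone_product_family:
  fixes P0 :: "'a measure" and Q0 :: "'b measure"
  assumes \<P>: "\<P> \<subseteq> space (prob_algebra M1)" and \<Q>: "\<Q> \<subseteq> space (prob_algebra M2)"
    and P0: "P0 \<in> \<P>" and Q0: "Q0 \<in> \<Q>"
    and g: "g \<in> tangent_cone (P0 \<Otimes>\<^sub>M Q0) (product_family \<P> \<Q>)"
  shows "(\<lambda>x. \<integral>y. g (x, y) \<partial>Q0) \<in> tangent_cone P0 \<P>"
    and "(\<lambda>y. \<integral>x. g (x, y) \<partial>P0) \<in> tangent_cone Q0 \<Q>"
    and "AE z in P0 \<Otimes>\<^sub>M Q0. g z = (\<integral>y. g (fst z, y) \<partial>Q0) + (\<integral>x. g (x, snd z) \<partial>P0)"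
proof -
  have prob_\<P>: "prob_space p \<and> sets p = sets P0" if "p \<in> \<P>" for p
    using that \<P> P0 by (auto simp: space_prob_algebra)
  have prob_\<Q>: "prob_space q \<and> sets q = sets Q0" if "q \<in> \<Q>" for q
    using that \<Q> Q0 by (auto simp: space_prob_algebra)
  interpret P0: prob_space P0 using prob_\<P>[OF P0] by blast
  interpret Q0: prob_space Q0 using prob_\<Q>[OF Q0] by blast
  interpret R0: pair_prob_space P0 Q0 ..
  let ?R = "P0 \<Otimes>\<^sub>M Q0"
  let ?g1 = "\<lambda>x. \<integral>y. g (x, y) \<partial>Q0" and ?g2 = "\<lambda>y. \<integral>x. g (x, y) \<partial>P0"
  interpret E1: L2_projection ?R P0 fst "\<lambda>h x. \<integral>y. h (x, y) \<partial>Q0"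
    by (rule L2_projection_fst) unfold_locales
  interpret E2: L2_projection ?R Q0 snd "\<lambda>h y. \<integral>x. h (x, y) \<partial>P0"
    by (rule L2_projection_snd) unfold_locales
  obtain S \<epsilon> L where S0: "S 0 = ?R" and gL: "g \<in> L2 ?R" and \<epsilon>: "\<epsilon> > 0"
    and S: "\<And>t. t \<in> {-\<epsilon><..<\<epsilon>} \<Longrightarrow> S t \<in> product_family \<P> \<Q> \<and> is_density_quotient (S t) ?R (L t)"
    and norm: "(\<lambda>t. L2_norm ?R (\<lambda>z. 2 * (sqrt (enn2real (L t z)) - 1) - t * g z)) \<in> o[at 0](\<lambda>t. \<bar>t\<bar>)"
    and sing: "(\<lambda>t. measure (S t) {z \<in> space ?R. L t z = \<infinity>}) \<in> o[at 0](\<lambda>t. t\<^sup>2)"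
    using g unfolding tangent_cone_def L2_differentiable_curve_def by force
  define \<rho> where "\<rho> t = L2_norm ?R (\<lambda>z. 2 * (sqrt (enn2real (L t z)) - 1) - t * g z)" for t
  have \<rho>: "\<rho> \<in> o[at 0](\<lambda>t. \<bar>t\<bar>)"
    using norm unfolding \<rho>_def[abs_def] .
  \<comment> \<open>The factors are chosen separately for each \<open>t\<close>; the clause for
    \<open>t = 0\<close> makes the chosen curves start at \<open>P0\<close> and
    \<open>Q0\<close>.\<close>
  have "\<exists>p q. t \<in> {-\<epsilon><..<\<epsilon>} \<longrightarrow> p \<in> \<P> \<and> q \<in> \<Q> \<and> S t = p \<Otimes>\<^sub>M q \<and> (t = 0 \<longrightarrow> p = P0 \<and> q = Q0)" for t
    using S[of t] S0 P0 Q0 by (cases "t = 0") (auto simp: product_family_def)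
  then obtain T U where TU: "\<And>t. t \<in> {-\<epsilon><..<\<epsilon>} \<Longrightarrow> T t \<in> \<P> \<and> U t \<in> \<Q> \<and> S t = T t \<Otimes>\<^sub>M U t
      \<and> (t = 0 \<longrightarrow> T t = P0 \<and> U t = Q0)"
    by metis
  have "\<exists>K N. t \<in> {-\<epsilon><..<\<epsilon>} \<longrightarrow> is_density_quotient (T t) P0 K \<and> is_density_quotient (U t) Q0 N" for t
  proof (cases "t \<in> {-\<epsilon><..<\<epsilon>}")
    case True
    then have "T t \<in> \<P>" "U t \<in> \<Q>" using TU by blast+
    then show ?thesis
      using density_quotient_exists[of "T t" P0] density_quotient_exists[of "U t" Q0]
        prob_\<P> prob_\<Q> P0 Q0 by metis
  qed blast
  then obtain K N where KN: "\<And>t. t \<in> {-\<epsilon><..<\<epsilon>} \<Longrightarrow> is_density_quotient (T t) P0 (K t) \<and> is_density_quotient (U t) Q0 (N t)"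
    by metis
  let ?f = "\<lambda>t x. sqrt (enn2real (K t x))" and ?h = "\<lambda>t y. sqrt (enn2real (N t y))"
  have prob_T: "prob_space (T t)" "sets (T t) = sets P0" if "t \<in> {-\<epsilon><..<\<epsilon>}" for t
    using prob_\<P> TU[OF that] by blast+
  have prob_U: "prob_space (U t)" "sets (U t) = sets Q0" if "t \<in> {-\<epsilon><..<\<epsilon>}" for t
    using prob_\<Q> TU[OF that] by blast+
  have prob_S: "prob_space (S t) \<and> sets (S t) = sets ?R" if t: "t \<in> {-\<epsilon><..<\<epsilon>}" for t
  proof -
    interpret T: prob_space "T t" by (rule prob_T[OF t])
    interpret U: prob_space "U t" by (rule prob_U[OF t])
    interpret pair_prob_space "T t" "U t" ..
    show ?thesis
      using TU[OF t] prob_space_axioms sets_pair_measure_cong[OF prob_T(2)[OF t] prob_U(2)[OF t]] by simp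
  qed
  have f: "?f t \<in> L2 P0" "L2_norm P0 (?f t) \<le> 1" and h: "?h t \<in> L2 Q0" "L2_norm Q0 (?h t) \<le> 1"
    if t: "t \<in> {-\<epsilon><..<\<epsilon>}" for t
    using density_quotient_sqrt[OF prob_T[OF t] conjunct1[OF KN[OF t]]]
      density_quotient_sqrt[OF prob_U[OF t] conjunct2[OF KN[OF t]]] by blast+
  have \<rho>_eq: "\<rho> t = L2_norm ?R (\<lambda>z. 2 * (?f t (fst z) * ?h t (snd z) - 1) - t * g z)"
    if t: "t \<in> {-\<epsilon><..<\<epsilon>}" for t
  proof -
    have St: "S t = T t \<Otimes>\<^sub>M U t" using TU[OF t] by blast
    have "is_density_quotient (S t) ?R
      (\<lambda>z. if K t (fst z) = \<infinity> \<or> N t (snd z) = \<infinity> then \<infinity> else K t (fst z) * N t (snd z))"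
      unfolding St
      using prob_T[OF t] prob_U[OF t] KN[OF t] P0.prob_space_axioms Q0.prob_space_axioms
      by (intro density_quotient_pair) blast+
    with S[OF t] prob_S[OF t] have
      "AE z in ?R. L t z = (if K t (fst z) = \<infinity> \<or> N t (snd z) = \<infinity> then \<infinity> else K t (fst z) * N t (snd z))"
      by (intro density_quotient_unique[of "S t" ?R]) (auto intro: R0.prob_space_axioms)
    \<comment> \<open>Where a quotient of a factor is infinite, both sides are 0, because
      \<open>enn2real\<close> sends \<infinity> to 0.\<close>
    then have AE: "AE z in ?R. sqrt (enn2real (L t z)) = ?f t (fst z) * ?h t (snd z)"
      by eventually_elim (auto simp: enn2real_mult real_sqrt_mult)
    have [measurable]: "L t \<in> borel_measurable ?R" "g \<in> borel_measurable ?R"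
      using S[OF t] gL by (auto simp: is_density_quotient_def L2_def)
    have [measurable]: "?f t \<in> borel_measurable P0" "?h t \<in> borel_measurable Q0"
      using f[OF t] h[OF t] by (auto simp: L2_def)
    show ?thesis
      unfolding \<rho>_def
    proof (rule L2_norm_cong_AE)
      show "AE z in ?R. 2 * (sqrt (enn2real (L t z)) - 1) - t * g z
          = 2 * (?f t (fst z) * ?h t (snd z) - 1) - t * g z"
        using AE by eventually_elim simp
    qed measurable
  qed
  have bounds: "t * (\<integral>z. g z \<partial>?R) \<le> \<rho> t"
    "(\<integral>z. g z \<partial>?R) = 0 \<Longrightarrow> L2_norm P0 (\<lambda>x. 2 * (?f t x - 1) - t * ?g1 x) \<le> 2 * \<rho> t"
    "(\<integral>z. g z \<partial>?R) = 0 \<Longrightarrow> L2_norm Q0 (\<lambda>y. 2 * (?h t y - 1) - t * ?g2 y) \<le> 2 * \<rho> t"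
    "(\<integral>z. g z \<partial>?R) = 0 \<Longrightarrow> \<bar>t\<bar> * L2_norm ?R (\<lambda>z. g z - (?g1 (fst z) + ?g2 (snd z))) \<le> 5 * \<rho> t
      + (2 * \<rho> t + \<bar>t\<bar> * L2_norm P0 ?g1) * (2 * \<rho> t + \<bar>t\<bar> * L2_norm Q0 ?g2) / 2"
    if t: "t \<in> {-\<epsilon><..<\<epsilon>}" for t
    unfolding \<rho>_eq[OF t]
    by (rule pair_root_bounds[OF P0.prob_space_axioms Q0.prob_space_axioms f[OF t] _ h[OF t] _ gL]; simp)+
  have ev: "\<forall>\<^sub>F t in at 0. t \<in> {-\<epsilon><..<\<epsilon>}"
    using \<epsilon> by (intro eventually_at_in_open') auto
  have m: "(\<integral>z. g z \<partial>?R) = 0"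
  proof (rule smallo_abs_linear_le_imp_eq_0[OF \<rho>])
    show "\<forall>\<^sub>F t in at 0. t * (\<integral>z. g z \<partial>?R) \<le> \<rho> t"
      using ev by eventually_elim (rule bounds(1))
  qed
  have zero: "0 \<in> {-\<epsilon><..<\<epsilon>}" using \<epsilon> by simp
  have "L2_differentiable_curve \<P> T ?g1"
  proof (rule E1.L2_differentiable_curve_proj[OF \<epsilon> gL conjunct2[OF S] sing prob_S _ _ _ \<rho>])
    show "T 0 = P0" using TU[OF zero] by blast
    fix t assume t: "t \<in> {-\<epsilon><..<\<epsilon>}"
    show "L2_norm P0 (\<lambda>x. 2 * (?f t x - 1) - t * ?g1 x) \<le> 2 * \<rho> t"
      by (rule bounds(2)[OF t m])
    have "distr (S t) P0 fst = distr (T t \<Otimes>\<^sub>M U t) (T t) fst"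
      using TU[OF t] prob_T[OF t] by (intro distr_cong) auto
    also have "\<dots> = T t"
      using prob_U[OF t] by (intro prob_space.distr_pair_fst)
    finally show "T t \<in> \<P> \<and> distr (S t) P0 fst = T t \<and> is_density_quotient (T t) P0 (K t)"
      using TU[OF t] KN[OF t] by blast
  qed
  then show "?g1 \<in> tangent_cone P0 \<P>"
    unfolding tangent_cone_def using TU[OF zero] by blast
  have "L2_differentiable_curve \<Q> U ?g2"
  proof (rule E2.L2_differentiable_curve_proj[OF \<epsilon> gL conjunct2[OF S] sing prob_S _ _ _ \<rho>])
    show "U 0 = Q0" using TU[OF zero] by blast
    fix t assume t: "t \<in> {-\<epsilon><..<\<epsilon>}"
    show "L2_norm Q0 (\<lambda>y. 2 * (?h t y - 1) - t * ?g2 y) \<le> 2 * \<rho> t"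
      by (rule bounds(3)[OF t m])
    have "distr (S t) Q0 snd = distr (T t \<Otimes>\<^sub>M U t) (U t) snd"
      using TU[OF t] prob_U[OF t] by (intro distr_cong) auto
    also have "\<dots> = U t"
      using prob_T[OF t] prob_U[OF t] by (intro distr_pair_snd)
    finally show "U t \<in> \<Q> \<and> distr (S t) Q0 snd = U t \<and> is_density_quotient (U t) Q0 (N t)"
      using TU[OF t] KN[OF t] by blast
  qed
  then show "?g2 \<in> tangent_cone Q0 \<Q>"
    unfolding tangent_cone_def using TU[OF zero] by blast
  let ?d = "\<lambda>z. g z - (?g1 (fst z) + ?g2 (snd z))"
  have d: "?d \<in> L2 ?R"
    by (intro L2_diff L2_add E1.pullback_L2 E2.pullback_L2 E1.proj_L2 E2.proj_L2 gL)
  have "L2_norm ?R ?d = 0"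
  proof (rule smallo_abs_quadratic_le_imp_eq_0[OF \<rho>])
    show "\<forall>\<^sub>F t in at 0. \<bar>t\<bar> * L2_norm ?R ?d \<le> 5 * \<rho> t
        + (2 * \<rho> t + \<bar>t\<bar> * L2_norm P0 ?g1) * (2 * \<rho> t + \<bar>t\<bar> * L2_norm Q0 ?g2) / 2"
      using ev
    proof eventually_elim
      case (elim t)
      show ?case
        by (rule bounds(4)[OF elim m])
    qed
  qed (simp_all add: L2_norm_nonneg \<rho>_def)
  then have "AE z in ?R. ?d z = 0"
    using L2_norm_eq_0_iff[OF d] by blast
  then show "AE z in ?R. g z = ?g1 (fst z) + ?g2 (snd z)"
    by eventually_elim simp
qed

section \<open>Splitting of the tangent space and conclusion\<close>

text \<open>The map from \<open>h\<close> to \<open>h\<close> minus its two coordinate integrals is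
  linear up to null sets and vanishes on the cone, hence on its span. Its norm is at most 3, the sum
  of the norms of three contractions, so it vanishes on the closure as well.\<close>

lemma tangent_space_product_family:
  fixes P0 :: "'a measure" and Q0 :: "'b measure"
  assumes "prob_space P0" "prob_space Q0"
    and cone: "\<And>g. g \<in> tangent_cone (P0 \<Otimes>\<^sub>M Q0) \<R> \<Longrightarrow>
      AE z in P0 \<Otimes>\<^sub>M Q0. g z = (\<integral>y. g (fst z, y) \<partial>Q0) + (\<integral>x. g (x, snd z) \<partial>P0)"
    and h: "h \<in> tangent_space (P0 \<Otimes>\<^sub>M Q0) \<R>"
  shows "AE z in P0 \<Otimes>\<^sub>M Q0. h z = (\<integral>y. h (fst z, y) \<partial>Q0) + (\<integral>x. h (x, snd z) \<partial>P0)"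
proof -
  let ?R = "P0 \<Otimes>\<^sub>M Q0"
  let ?E1 = "\<lambda>h x. \<integral>y. h (x, y) \<partial>Q0" and ?E2 = "\<lambda>h y. \<integral>x. h (x, y) \<partial>P0"
  interpret E1: L2_projection ?R P0 fst ?E1
    by (rule L2_projection_fst) fact+
  interpret E2: L2_projection ?R Q0 snd ?E2
    by (rule L2_projection_snd) fact+
  have hL: "h \<in> L2 ?R" and approx: "\<And>e. e > 0 \<Longrightarrow> \<exists>s\<in>linear_span (tangent_cone ?R \<R>). L2_norm ?R (\<lambda>z. h z - s z) < e"
    using h by (auto simp: tangent_space_def L2_closure_def)
  let ?d = "\<lambda>z. h z - (?E1 h (fst z) + ?E2 h (snd z))"
  have d: "?d \<in> L2 ?R"
    by (intro L2_diff L2_add E1.pullback_L2 E2.pullback_L2 E1.proj_L2 E2.proj_L2 hL)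
  have "L2_norm ?R ?d < 3 * e" if e: "e > 0" for e
  proof -
    obtain s where s: "s \<in> linear_span (tangent_cone ?R \<R>)" and lt: "L2_norm ?R (\<lambda>z. h z - s z) < e"
      using approx[OF e] by blast
    obtain F c where F: "finite F" "F \<subseteq> tangent_cone ?R \<R>" and s_eq: "s = (\<lambda>z. \<Sum>f\<in>F. c f * f z)"
      using s by (auto simp: linear_span_def)
    have FL: "f \<in> L2 ?R" if "f \<in> F" for f
      using F that by (auto simp: tangent_cone_def L2_differentiable_curve_def)
    have sL: "s \<in> L2 ?R"
      unfolding s_eq using FL by (intro L2_sum L2_cmult)
    have "AE z in ?R. \<forall>f\<in>F. f z = ?E1 f (fst z) + ?E2 f (snd z)"
      using F cone by (intro AE_finite_allI) auto
    moreover have "AE z in ?R. ?E1 s (fst z) = (\<Sum>f\<in>F. c f * ?E1 f (fst z))"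
      unfolding s_eq by (intro E1.AE_pullback E1.proj_sum FL)
    moreover have "AE z in ?R. ?E2 s (snd z) = (\<Sum>f\<in>F. c f * ?E2 f (snd z))"
      unfolding s_eq by (intro E2.AE_pullback E2.proj_sum FL)
    ultimately have s_split: "AE z in ?R. s z = ?E1 s (fst z) + ?E2 s (snd z)"
      by eventually_elim (simp add: s_eq sum.distrib[symmetric] distrib_left[symmetric])
    let ?v = "\<lambda>z. h z - s z"
    have v: "?v \<in> L2 ?R" using L2_diff[OF hL sL] .
    have "AE z in ?R. ?d z = ?v z - (?E1 ?v (fst z) + ?E2 ?v (snd z))"
      using s_split E1.AE_pullback[OF E1.proj_diff[OF hL sL]] E2.AE_pullback[OF E2.proj_diff[OF hL sL]]
      by eventually_elim simp
    then have "L2_norm ?R ?d = L2_norm ?R (\<lambda>z. ?v z - (?E1 ?v (fst z) + ?E2 ?v (snd z)))"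
      by (rule L2_norm_cong_AE)
         (intro L2_measurable d L2_diff L2_add E1.pullback_L2 E2.pullback_L2 E1.proj_L2 E2.proj_L2 hL sL)+
    also have "\<dots> \<le> L2_norm ?R ?v + L2_norm ?R (\<lambda>z. ?E1 ?v (fst z) + ?E2 ?v (snd z))"
      by (intro L2_norm_triangle_diff L2_add v E1.pullback_L2 E2.pullback_L2 E1.proj_L2 E2.proj_L2)
    also have "L2_norm ?R (\<lambda>z. ?E1 ?v (fst z) + ?E2 ?v (snd z))
        \<le> L2_norm ?R (\<lambda>z. ?E1 ?v (fst z)) + L2_norm ?R (\<lambda>z. ?E2 ?v (snd z))"
      by (intro L2_norm_triangle v E1.pullback_L2 E2.pullback_L2 E1.proj_L2 E2.proj_L2)
    also have "L2_norm ?R (\<lambda>z. ?E1 ?v (fst z)) = L2_norm P0 (?E1 ?v)"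
      by (intro E1.L2_norm_pullback L2_measurable E1.proj_L2 v)
    also have "\<dots> \<le> L2_norm ?R ?v"
      by (rule E1.L2_norm_proj_le[OF v])
    also have "L2_norm ?R (\<lambda>z. ?E2 ?v (snd z)) = L2_norm Q0 (?E2 ?v)"
      by (intro E2.L2_norm_pullback L2_measurable E2.proj_L2 v)
    also have "\<dots> \<le> L2_norm ?R ?v"
      by (rule E2.L2_norm_proj_le[OF v])
    finally show ?thesis using lt by simp
  qed
  from this[of "L2_norm ?R ?d / 3"] have "L2_norm ?R ?d = 0"
    using L2_norm_nonneg[of ?R ?d] by linarith
  then have "AE z in ?R. ?d z = 0"
    using L2_norm_eq_0_iff[OF d] by blast
  then show ?thesis
    by eventually_elim simp
qed

theorem mainTheorem1:
  fixes M1 :: "'a measure" and M2 :: "'b measure"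
    and \<P> :: "'a measure set" and \<Q> :: "'b measure set"
    and P0 :: "'a measure" and Q0 :: "'b measure"
    and k :: "('a \<times> 'b) measure \<Rightarrow> real"
    and kd kt :: "'a \<times> 'b \<Rightarrow> real"
  assumes "\<P> \<subseteq> space (prob_algebra M1)" and "\<P> \<noteq> {}"
    and "\<Q> \<subseteq> space (prob_algebra M2)" and "\<Q> \<noteq> {}"
    and "P0 \<in> \<P>" and "Q0 \<in> \<Q>"
    and "functional_differentiable (product_family \<P> \<Q>) k (P0 \<Otimes>\<^sub>M Q0)"
    and "is_gradient (product_family \<P> \<Q>) k (P0 \<Otimes>\<^sub>M Q0) kd"
    and "is_canonical_gradient (product_family \<P> \<Q>) k (P0 \<Otimes>\<^sub>M Q0) kt"
  shows
    "(functional_differentiable \<P> (\<lambda>P. k (P \<Otimes>\<^sub>M Q0)) P0 \<and>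
      functional_differentiable \<Q> (\<lambda>Q. k (P0 \<Otimes>\<^sub>M Q)) Q0) \<and>
     (is_gradient \<P> (\<lambda>P. k (P \<Otimes>\<^sub>M Q0)) P0 (\<lambda>x. \<integral>y. kd (x, y) \<partial>Q0) \<and>
      is_gradient \<Q> (\<lambda>Q. k (P0 \<Otimes>\<^sub>M Q)) Q0 (\<lambda>y. \<integral>x. kd (x, y) \<partial>P0)) \<and>
     (is_canonical_gradient \<P> (\<lambda>P. k (P \<Otimes>\<^sub>M Q0)) P0 (\<lambda>x. \<integral>y. kt (x, y) \<partial>Q0) \<and>
      is_canonical_gradient \<Q> (\<lambda>Q. k (P0 \<Otimes>\<^sub>M Q)) Q0 (\<lambda>y. \<integral>x. kt (x, y) \<partial>P0)) \<and>
     (AE z in P0 \<Otimes>\<^sub>M Q0.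
        kt z = (\<integral>y. kt (fst z, y) \<partial>Q0) + (\<integral>x. kt (x, snd z) \<partial>P0))"
proof -
  let ?R = "P0 \<Otimes>\<^sub>M Q0" and ?\<R> = "product_family \<P> \<Q>"
  have prob: "prob_space P0" "prob_space Q0"
    using assms(1,3,5,6) by (auto simp: space_prob_algebra)
  interpret E1: L2_projection ?R P0 fst "\<lambda>h x. \<integral>y. h (x, y) \<partial>Q0"
    by (rule L2_projection_fst) fact+
  interpret E2: L2_projection ?R Q0 snd "\<lambda>h y. \<integral>x. h (x, y) \<partial>P0"
    by (rule L2_projection_snd) fact+
  note cone = tangent_cone_product_family[OF assms(1,3,5,6)]
  \<comment> \<open>Stated for an arbitrary gradient \<open>d\<close>, as it serves both
    \<open>kd\<close> and \<open>kt\<close>.\<close>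
  have grad1: "is_gradient \<P> (\<lambda>P. k (P \<Otimes>\<^sub>M Q0)) P0 (\<lambda>x. \<integral>y. d (x, y) \<partial>Q0)"
    if "is_gradient ?\<R> k ?R d" for d
    by (rule E1.is_gradient_proj[where \<Phi> = "\<lambda>P. P \<Otimes>\<^sub>M Q0", OF that assms(5) refl])
       (rule L2_differentiable_curve_pair_left[OF assms(1) prob(2) assms(6)])
  have grad2: "is_gradient \<Q> (\<lambda>Q. k (P0 \<Otimes>\<^sub>M Q)) Q0 (\<lambda>y. \<integral>x. d (x, y) \<partial>P0)"
    if "is_gradient ?\<R> k ?R d" for d
    by (rule E2.is_gradient_proj[where \<Phi> = "\<lambda>Q. P0 \<Otimes>\<^sub>M Q", OF that assms(6) refl])
       (rule L2_differentiable_curve_pair_right[OF assms(3) prob(1) assms(5)])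
  have kt: "is_gradient ?\<R> k ?R kt" "kt \<in> tangent_space ?R ?\<R>"
    using assms(9) by (simp_all add: is_canonical_gradient_def)
  have "is_canonical_gradient \<P> (\<lambda>P. k (P \<Otimes>\<^sub>M Q0)) P0 (\<lambda>x. \<integral>y. kt (x, y) \<partial>Q0)"
    by (intro canonical_gradientI grad1 kt(1) E1.proj_tangent_space[OF cone(1) kt(2)])
  moreover have "is_canonical_gradient \<Q> (\<lambda>Q. k (P0 \<Otimes>\<^sub>M Q)) Q0 (\<lambda>y. \<integral>x. kt (x, y) \<partial>P0)"
    by (intro canonical_gradientI grad2 kt(1) E2.proj_tangent_space[OF cone(2) kt(2)])
  moreover have "AE z in ?R. kt z = (\<integral>y. kt (fst z, y) \<partial>Q0) + (\<integral>x. kt (x, snd z) \<partial>P0)"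
    by (rule tangent_space_product_family[OF prob cone(3) kt(2)])
  ultimately show ?thesis
    using grad1[OF assms(8)] grad2[OF assms(8)] unfolding functional_differentiable_def by blast
qed

end
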